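(* Assume CH. Let $\mathbb P$ be a countable forcing poset. Then every countably infinite almost disjoint family on $\omega$ can be extended to a $\mathbb P$-indestructible fin-intersecting MAD family $\mathcal A$ on $\omega$ such that $\Vdash_{\mathbb P}$ "$\check{\mathcal A}$ is fin-intersecting". In other words, $\mathbb P$-indestructible fin-intersecting MAD families for which forcing with $\mathbb P$ preserves the fin-intersecting property exist generically.
   Context: An almost disjoint family on $\omega$ is an infinite set $\mathcal A$ of infinite subsets of $\omega$ such that $a\cap b$ is finite for all distinct $a,b\in\mathcal A$; it is MAD if it is not properly contained in any other almost disjoint family on $\omega$. A fin sequence is a function $C:\omega\to[\omega]^{<\omega}\setminus\{\emptyset\}$ with $C(n)\cap C(m)=\emptyset$ whenever $n\neq m$. A collection of sets is centered if every finite nonempty subcollection has infinite intersection. An almost disjoint family $\mathcal A$ is fin-intersecting if for every fin sequence $C$ there exists an infinite $I\subseteq\omega$ such that $\{\{n\in I: a\cap C(n)\neq\emptyset\}: a\in\mathcal A\}\setminus[I]^{<\omega}$ is centered, where $[I]^{<\omega}$ is the set of finite subsets of $I$. A MAD family $\mathcal A$ is $\mathbb P$-indestructible if $\Vdash_{\mathbb P}$ "$\check{\mathcal A}$ is MAD". Almost disjoint families with a property $\phi$ exist generically if every almost disjoint family of cardinality less than $\mathfrak c=2^{\aleph_0}$ is contained in an almost disjoint family with property $\phi$. *)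

theory Defs
  imports "HOL-Library.Countable_Set"
begin

unbundle cardinal_syntax

section \<open>Almost disjoint families\<close>

definition continuum_hypothesis :: bool where
  "continuum_hypothesis \<longleftrightarrow> |UNIV :: nat set set| =o cardSuc natLeq"

definition almost_disjoint_family :: "nat set set \<Rightarrow> bool" where
  "almost_disjoint_family A \<longleftrightarrow>
     infinite A \<and> (\<forall>a\<in>A. infinite a) \<and> (\<forall>a\<in>A. \<forall>b\<in>A. a \<noteq> b \<longrightarrow> finite (a \<inter> b))"

definition mad :: "nat set set \<Rightarrow> bool" where
  "mad A \<longleftrightarrow> almost_disjoint_family A \<and> \<not> (\<exists>B. almost_disjoint_family B \<and> A \<subset> B)"

definition fin_sequence :: "(nat \<Rightarrow> nat set) \<Rightarrow> bool" where
  "fin_sequence C \<longleftrightarrow>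
     (\<forall>n. finite (C n) \<and> C n \<noteq> {}) \<and> (\<forall>n m. n \<noteq> m \<longrightarrow> C n \<inter> C m = {})"

definition centered :: "nat set set \<Rightarrow> bool" where
  "centered S \<longleftrightarrow> (\<forall>F. F \<subseteq> S \<and> finite F \<and> F \<noteq> {} \<longrightarrow> infinite (\<Inter>F))"

definition fin_intersecting :: "nat set set \<Rightarrow> bool" where
  "fin_intersecting A \<longleftrightarrow> almost_disjoint_family A \<and>
     (\<forall>C. fin_sequence C \<longrightarrow>
        (\<exists>I. infinite I \<and>
           centered ({{n\<in>I. a \<inter> C n \<noteq> {}} | a. a \<in> A} - {x. x \<subseteq> I \<and> finite x})))"

definition exist_generically :: "(nat set set \<Rightarrow> bool) \<Rightarrow> bool" where
  "exist_generically \<phi> \<longleftrightarrow>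
     (\<forall>B. almost_disjoint_family B \<and> |B| <o |UNIV :: nat set set| \<longrightarrow>
        (\<exists>A. almost_disjoint_family A \<and> B \<subseteq> A \<and> \<phi> A))"


section \<open>Forcing\<close>

text \<open>
  A statement of the forcing language is represented by the predicate
  \<open>\<lambda>p. p \<tturnstile> \<phi>\<close> on conditions; the connectives below are the recursion clauses of
  the forcing relation, with \<open>\<longrightarrow>\<close>, \<open>\<exists>\<close> the classical abbreviations.
  Only objects of the first few levels over \<open>\<omega>\<close> occur in the statements to be
  forced, so names are typed: a name for a subset of \<open>\<omega>\<close> is a set of pairs
  \<open>(n, p)\<close>, standing for the usual name \<open>{(\<check>n, p), \<dots>}\<close>, and a name for a set of
  subsets of \<open>\<omega>\<close> is a set of pairs (name for a subset of \<open>\<omega>\<close>, condition).  Every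
  subset of \<open>\<omega>\<close>, and every set of such subsets, in a generic extension has a name
  of this form.
\<close>

type_synonym 'p statement = "'p \<Rightarrow> bool"
type_synonym 'p set_name = "(nat \<times> 'p) set"
type_synonym 'p family_name = "('p set_name \<times> 'p) set"

text \<open>Only a preorder is required, as is customary for forcing; \<open>(q, p) \<in> le\<close> means
  that \<open>q\<close> is stronger than \<open>p\<close>.\<close>

locale forcing_poset =
  fixes P :: "'p set" and le :: "'p rel" and one :: 'p
  assumes preorder: "preorder_on P le"
    and one_in: "one \<in> P"
    and one_greatest: "p \<in> P \<Longrightarrow> (p, one) \<in> le"
begin

definition set_names :: "'p set_name set" where
  "set_names = Pow (UNIV \<times> P)"

definition family_names :: "'p family_name set" where
  "family_names = Pow (set_names \<times> P)"

text \<open>The canonical name for the set whose elements are (named by) the members of \<open>X\<close>.\<close>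

definition up :: "'x set \<Rightarrow> ('x \<times> 'p) set" where
  "up X = X \<times> {one}"

definition check_family :: "nat set set \<Rightarrow> 'p family_name" where
  "check_family A = up (up ` A)"

definition forced :: "'p statement \<Rightarrow> bool" where
  "forced \<phi> \<longleftrightarrow> (\<forall>p\<in>P. \<phi> p)"

definition fNot :: "'p statement \<Rightarrow> 'p statement" ("\<^bold>\<not> _" [40] 40) where
  "(\<^bold>\<not> \<phi>) = (\<lambda>p. \<forall>q. (q, p) \<in> le \<longrightarrow> \<not> \<phi> q)"

definition fAnd :: "'p statement \<Rightarrow> 'p statement \<Rightarrow> 'p statement" (infixr "\<^bold>\<and>" 35) where
  "(\<phi> \<^bold>\<and> \<psi>) = (\<lambda>p. \<phi> p \<and> \<psi> p)"

definition fAll :: "'x set \<Rightarrow> ('x \<Rightarrow> 'p statement) \<Rightarrow> 'p statement" where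
  "fAll D \<phi> = (\<lambda>p. \<forall>x\<in>D. \<phi> x p)"

definition fImp :: "'p statement \<Rightarrow> 'p statement \<Rightarrow> 'p statement" (infixr "\<^bold>\<longrightarrow>" 25) where
  "(\<phi> \<^bold>\<longrightarrow> \<psi>) = (\<^bold>\<not> (\<phi> \<^bold>\<and> (\<^bold>\<not> \<psi>)))"

definition fIff :: "'p statement \<Rightarrow> 'p statement \<Rightarrow> 'p statement" (infixr "\<^bold>\<longleftrightarrow>" 25) where
  "(\<phi> \<^bold>\<longleftrightarrow> \<psi>) = ((\<phi> \<^bold>\<longrightarrow> \<psi>) \<^bold>\<and> (\<psi> \<^bold>\<longrightarrow> \<phi>))"

definition fEx :: "'x set \<Rightarrow> ('x \<Rightarrow> 'p statement) \<Rightarrow> 'p statement" where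
  "fEx D \<phi> = (\<^bold>\<not> fAll D (\<lambda>x. \<^bold>\<not> \<phi> x))"

text \<open>An absolute statement about ground model objects.\<close>

definition ground :: "bool \<Rightarrow> 'p statement" where
  "ground b = (\<lambda>p. b)"

definition num_mem :: "nat \<Rightarrow> 'p set_name \<Rightarrow> 'p statement" where
  "num_mem n x = (\<lambda>p. \<forall>q. (q, p) \<in> le \<longrightarrow>
     (\<exists>r. (r, q) \<in> le \<and> (\<exists>s. (n, s) \<in> x \<and> (r, s) \<in> le)))"

definition set_eq :: "'p set_name \<Rightarrow> 'p set_name \<Rightarrow> 'p statement" where
  "set_eq x y = fAll UNIV (\<lambda>n. num_mem n x \<^bold>\<longleftrightarrow> num_mem n y)"

definition set_mem :: "'p set_name \<Rightarrow> 'p family_name \<Rightarrow> 'p statement" where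
  "set_mem x X = (\<lambda>p. \<forall>q. (q, p) \<in> le \<longrightarrow>
     (\<exists>r. (r, q) \<in> le \<and> (\<exists>y s. (y, s) \<in> X \<and> (r, s) \<in> le \<and> set_eq x y r)))"

definition family_subset :: "'p family_name \<Rightarrow> 'p family_name \<Rightarrow> 'p statement" where
  "family_subset X Y = fAll set_names (\<lambda>x. set_mem x X \<^bold>\<longrightarrow> set_mem x Y)"

definition family_eq :: "'p family_name \<Rightarrow> 'p family_name \<Rightarrow> 'p statement" where
  "family_eq X Y = fAll set_names (\<lambda>x. set_mem x X \<^bold>\<longleftrightarrow> set_mem x Y)"

text \<open>
  A finite set is one of the form \<open>{x\<^sub>1, \<dots>, x\<^sub>k}\<close>.  In the extension the number \<open>k\<close>
  is a natural number and, below a suitable condition, the \<open>x\<^sub>i\<close> are natural numbers,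
  respectively objects named by some \<open>y\<^sub>i\<close>; hence the quantifier over finite sets \<open>E\<close> of
  numbers, respectively names.  For subsets of \<open>\<omega>\<close> the argument is the statement
  defining the set, so that it also applies to sets given by comprehension.
\<close>

definition fin_num :: "(nat \<Rightarrow> 'p statement) \<Rightarrow> 'p statement" where
  "fin_num \<phi> = fEx {E. finite E} (\<lambda>E. fAll UNIV (\<lambda>n. \<phi> n \<^bold>\<longleftrightarrow> ground (n \<in> E)))"

definition fin_set :: "'p set_name \<Rightarrow> 'p statement" where
  "fin_set x = fin_num (\<lambda>n. num_mem n x)"

definition fin_family :: "'p family_name \<Rightarrow> 'p statement" where
  "fin_family X = fEx {E. finite E \<and> E \<subseteq> set_names} (\<lambda>E. family_eq X (up E))"

definition f_almost_disjoint_family :: "'p family_name \<Rightarrow> 'p statement" where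
  "f_almost_disjoint_family X =
     ((\<^bold>\<not> fin_family X) \<^bold>\<and>
      fAll set_names (\<lambda>x. set_mem x X \<^bold>\<longrightarrow> (\<^bold>\<not> fin_set x)) \<^bold>\<and>
      fAll set_names (\<lambda>x. fAll set_names (\<lambda>y.
        set_mem x X \<^bold>\<and> set_mem y X \<^bold>\<and> (\<^bold>\<not> set_eq x y) \<^bold>\<longrightarrow>
          fin_num (\<lambda>n. num_mem n x \<^bold>\<and> num_mem n y))))"

definition f_mad :: "'p family_name \<Rightarrow> 'p statement" where
  "f_mad X =
     (f_almost_disjoint_family X \<^bold>\<and>
      (\<^bold>\<not> fEx family_names (\<lambda>Y.
        f_almost_disjoint_family Y \<^bold>\<and> family_subset X Y \<^bold>\<and> (\<^bold>\<not> family_eq X Y))))"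

text \<open>
  A sequence of subsets of \<open>\<omega>\<close> in the extension is named by a sequence of names for
  subsets of \<open>\<omega>\<close>: it is determined by the set of pairs \<open>(n, k)\<close> with \<open>k \<in> C(n)\<close>, and a
  name for a subset of \<open>\<omega> \<times> \<omega>\<close> amounts to a sequence of names for its sections.
\<close>

definition sequence_names :: "(nat \<Rightarrow> 'p set_name) set" where
  "sequence_names = {C. \<forall>n. C n \<in> set_names}"

definition meets :: "'p set_name \<Rightarrow> 'p set_name \<Rightarrow> 'p statement" where
  "meets x y = fEx UNIV (\<lambda>k. num_mem k x \<^bold>\<and> num_mem k y)"

definition f_fin_sequence :: "(nat \<Rightarrow> 'p set_name) \<Rightarrow> 'p statement" where
  "f_fin_sequence C =
     (fAll UNIV (\<lambda>n. fin_set (C n) \<^bold>\<and> fEx UNIV (\<lambda>k. num_mem k (C n))) \<^bold>\<and>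
      fAll UNIV (\<lambda>n. fAll UNIV (\<lambda>m. ground (n \<noteq> m) \<^bold>\<longrightarrow> (\<^bold>\<not> meets (C n) (C m)))))"

text \<open>Here the collection of subsets of \<open>\<omega>\<close> is given by its defining statement \<open>\<Phi>\<close>.\<close>

definition f_centered :: "('p set_name \<Rightarrow> 'p statement) \<Rightarrow> 'p statement" where
  "f_centered \<Phi> = fAll family_names (\<lambda>F.
     fAll set_names (\<lambda>x. set_mem x F \<^bold>\<longrightarrow> \<Phi> x) \<^bold>\<and> fin_family F \<^bold>\<and>
     fEx set_names (\<lambda>x. set_mem x F)
     \<^bold>\<longrightarrow> (\<^bold>\<not> fin_num (\<lambda>n. fAll set_names (\<lambda>x. set_mem x F \<^bold>\<longrightarrow> num_mem n x))))"

text \<open>The statement \<open>x \<in> {{n \<in> I. a \<inter> C(n) \<noteq> \<emptyset>} : a \<in> X} \<setminus> [I]\<^sup><\<^sup>\<omega>\<close>.\<close>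

definition infinite_trace ::
    "'p family_name \<Rightarrow> (nat \<Rightarrow> 'p set_name) \<Rightarrow> 'p set_name \<Rightarrow> 'p set_name \<Rightarrow> 'p statement" where
  "infinite_trace X C I x =
     (fEx set_names (\<lambda>a. set_mem a X \<^bold>\<and>
        fAll UNIV (\<lambda>n. num_mem n x \<^bold>\<longleftrightarrow> num_mem n I \<^bold>\<and> meets a (C n))) \<^bold>\<and>
      (\<^bold>\<not> (fAll UNIV (\<lambda>n. num_mem n x \<^bold>\<longrightarrow> num_mem n I) \<^bold>\<and> fin_set x)))"

definition f_fin_intersecting :: "'p family_name \<Rightarrow> 'p statement" where
  "f_fin_intersecting X =
     (f_almost_disjoint_family X \<^bold>\<and>
      fAll sequence_names (\<lambda>C. f_fin_sequence C \<^bold>\<longrightarrow>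
        fEx set_names (\<lambda>I. (\<^bold>\<not> fin_set I) \<^bold>\<and> f_centered (infinite_trace X C I))))"

definition indestructible :: "nat set set \<Rightarrow> bool" where
  "indestructible A \<longleftrightarrow> mad A \<and> forced (f_mad (check_family A))"

definition preserved_fin_intersecting :: "nat set set \<Rightarrow> bool" where
  "preserved_fin_intersecting A \<longleftrightarrow> forced (f_fin_intersecting (check_family A))"

end

end

theory Submission
  imports Defs "HOL-Library.Countable_Set_Type"
begin

text \<open>
  A name for a fin sequence \<open>C\<close> is replaced by the set of all triples \<open>(r, k, D)\<close> such that the
  condition \<open>r\<close> forces \<open>C(k) = D\<close>.  As \<open>P\<close> is countable, there are only \<open>2\<^sup>\<omega>\<close> sets \<open>K\<close> of
  triples, and under CH they can be listed so that each has countably many predecessors.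
  Starting with a countable almost disjoint family, one set \<open>a i\<close> is added at each index
  \<open>i\<close>, so the family present at that time is countable, and two things are done.

  First, the \<open>i\<close>-th set of triples is thinned out, below dense sets of conditions, until for
  every member \<open>b\<close> present it is decided whether \<open>b\<close> meets almost all of the remaining
  terms \<open>D\<close> or almost none of them (lemma \<open>ex_settling_subset\<close>); in the extension this
  is a pseudo-intersection argument.  Secondly, the traces of members added later have to be
  kept centered.  Consider an earlier set of triples, finitely many members \<open>F\<close>, a condition
  \<open>q\<close> and a number \<open>n\<close>, and let \<open>W\<close> be the union of the terms that meet all members of \<open>F\<close>,
  occur below \<open>q\<close> and have index beyond \<open>n\<close>.  If \<open>W\<close> is not covered by finitely many
  members, the new set \<open>a i\<close> is made to meet \<open>W\<close>.  There are countably many such demands, so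
  a simple diagonalization achieves all of them (lemmas \<open>ex_almost_disjoint_meeting\<close> and
  \<open>next_stage_exists\<close>).

  At the end (theorem \<open>absorbing_exists\<close>), either these demands were always met, and then
  the traces of the later members are centered while those of the earlier ones are finite
  or cofinite; or some \<open>W\<close> was covered by a finite set of members, and then below \<open>q\<close> these
  are the only ones with infinite trace on the indices of the covered terms, and thinning
  out once more makes every trace finite or cofinite (lemma
  \<open>ex_settling_subset_if_covered\<close>).  In both cases some member of the family meets infinitely
  many terms.  For the sequence of singletons of elements of an infinite set of the extension
  this says that some member has infinite intersection with it, which is maximality.

  The outcome is the combinatorial property \<open>absorbing\<close> of the final family, from which
  \<open>mad_check\<close> and \<open>fin_intersecting_check\<close> derive the forced statements.  The ground model
  is covered by the same construction, carried out for \<open>P\<close> together with one isolated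
  condition (lemma \<open>absorbing_family_exists\<close>).
\<close>

section \<open>Diagonalization under the continuum hypothesis\<close>

text \<open>
  The construction runs along this order: at each index only countably many earlier
  choices have to be respected.  No index is the last one, because its predecessors and
  itself would make up a countable continuum.
\<close>

lemma ex_well_order_with_countable_segments:
  assumes "continuum_hypothesis"
  obtains R :: "nat set rel" where "wf R" "trans R" "total R" "\<And>i. countable {j. (j, i) \<in> R}"
    "\<And>j. \<exists>i. (j, i) \<in> R"
proof -
  define r where "r = |UNIV :: nat set set|"
  have ch: "r =o cardSuc natLeq"
    using assms unfolding continuum_hypothesis_def r_def .
  have wo: "well_order_on UNIV r"
    unfolding r_def by (rule card_of_well_order_on)
  have lin: "trans r" "antisym r" "total r" "refl r"
    using wo unfolding well_order_on_def linear_order_on_def partial_order_on_def preorder_on_def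
    by auto
  have cnt: "countable {j. (j, i) \<in> r - Id}" for i
  proof -
    have "|underS r i| <o r"
      unfolding r_def by (rule card_of_underS) (simp_all add: card_of_card_order_on Field_card_of)
    also have "r =o cardSuc natLeq" by (rule ch)
    finally have "|underS r i| \<le>o natLeq"
      using cardSuc_ordLeq_ordLess[OF natLeq_Card_order card_of_Card_order] by blast
    then have "countable (underS r i)"
      by (simp add: countable_card_le_natLeq)
    then show ?thesis
      by (rule countable_subset[rotated]) (auto simp: underS_def)
  qed
  have unc: "uncountable (UNIV :: nat set set)"
  proof
    assume "countable (UNIV :: nat set set)"
    then have "r \<le>o natLeq"
      unfolding r_def by (simp add: countable_card_le_natLeq)
    then have "cardSuc natLeq \<le>o natLeq"
      using ch ordIso_symmetric ordIso_ordLeq_trans by blast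
    then show False
      using cardSuc_greater[OF natLeq_Card_order] not_ordLess_ordLeq by blast
  qed
  show ?thesis
  proof
    show "wf (r - Id)" using wo unfolding well_order_on_def by simp
    show "trans (r - Id)" using lin by (simp add: trans_diff_Id)
    show "total (r - Id)" using lin by simp
    show "countable {j. (j, i) \<in> r - Id}" for i by (rule cnt)
    show "\<exists>i. (j, i) \<in> r - Id" for j
    proof (rule ccontr)
      assume "\<nexists>i. (j, i) \<in> r - Id"
      then have "UNIV = insert j {i. (i, j) \<in> r - Id}"
        using lin(3) unfolding total_on_def by blast
      then show False using cnt[of j] unc by (metis countable_insert)
    qed
  qed
qed

lemma countable_if_less_continuum:
  assumes "continuum_hypothesis" "|B| <o |UNIV :: nat set set|"
  shows "countable B"
proof -
  have "|B| <o cardSuc natLeq"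
    using assms ordLess_ordIso_trans unfolding continuum_hypothesis_def by blast
  then have "|B| \<le>o natLeq"
    using cardSuc_ordLeq_ordLess[OF natLeq_Card_order card_of_Card_order] by blast
  then show ?thesis
    by (simp add: countable_card_le_natLeq)
qed

text \<open>
  List \<open>A\<close> as \<open>e 0, e 1, \<dots>\<close> and \<open>\<W>\<close> as \<open>w 0, w 1, \<dots>\<close>, and let \<open>a\<close> consist of one point of
  \<open>w n - (e 0 \<union> \<dots> \<union> e n)\<close> for each \<open>n\<close>: then only the first \<open>m\<close> of these points can
  belong to \<open>e m\<close>.  All the demands made on a new member of the family will be brought
  into the form ``meet \<open>W\<close>'', where \<open>W\<close> is not covered by finitely many old members.
\<close>

lemma ex_almost_disjoint_meeting:
  assumes "countable A" "A \<noteq> {}" "countable \<W>" "\<W> \<noteq> {}"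
    and unc: "\<And>W F. W \<in> \<W> \<Longrightarrow> finite F \<Longrightarrow> F \<subseteq> A \<Longrightarrow> \<not> W \<subseteq> \<Union>F"
  shows "\<exists>a :: 'x set. (\<forall>b\<in>A. finite (a \<inter> b)) \<and> (\<forall>W\<in>\<W>. a \<inter> W \<noteq> {})"
proof -
  define e where "e = from_nat_into A"
  define w where "w = from_nat_into \<W>"
  have e: "range e = A" and w: "range w = \<W>"
    using assms by (auto simp: e_def w_def)
  have "\<exists>x. \<forall>n. x n \<in> w n - \<Union>(e ` {..n})"
  proof (rule choice, rule)
    fix n
    have "\<not> w n \<subseteq> \<Union>(e ` {..n})"
      using unc[of "w n" "e ` {..n}"] e w by auto
    then show "\<exists>x. x \<in> w n - \<Union>(e ` {..n})" by blast
  qed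
  then obtain x where x: "\<And>n. x n \<in> w n - \<Union>(e ` {..n})" by blast
  show ?thesis
  proof (intro exI[of _ "range x"] conjI ballI)
    fix b assume "b \<in> A"
    then obtain m where m: "b = e m" using e by blast
    have "range x \<inter> b \<subseteq> x ` {..<m}"
    proof
      fix y assume "y \<in> range x \<inter> b"
      then obtain n where n: "y = x n" "x n \<in> e m" using m by auto
      then have "\<not> m \<le> n" using x[of n] by auto
      then show "y \<in> x ` {..<m}" using n by auto
    qed
    then show "finite (range x \<inter> b)" by (rule finite_subset) simp
  next
    fix W assume "W \<in> \<W>"
    then obtain n where "W = w n" using w by blast
    then show "range x \<inter> W \<noteq> {}" using x[of n] by auto
  qed
qed

section \<open>Approximations to sequences of finite sets in the extension\<close>

text \<open>
  The triple \<open>(r, k, D)\<close> is read ``\<open>r\<close> forces the \<open>k\<close>-th term of the sequence to be \<open>D\<close>''.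
  For a generic filter \<open>G\<close>, a downward closed set \<open>K\<close> of such triples determines the partial
  sequence with \<open>k \<mapsto> D\<close> whenever \<open>(r, k, D) \<in> K\<close> for some \<open>r \<in> G\<close>; the set of indices at
  which it is defined is called \<open>I\<close> here.  Passing to a subset of \<open>K\<close> amounts to
  shrinking \<open>I\<close>.  In these terms \<open>frequent le K q\<close> says that \<open>q\<close> forces \<open>I\<close> to be infinite,
  and \<open>settles le K b q\<close> that \<open>q\<close> decides, beyond a fixed bound, whether \<open>b\<close> meets every
  term of the sequence or none of them.
\<close>

type_synonym 'q approximation = "('q \<times> nat \<times> nat set) set"

definition late_values :: "'q rel \<Rightarrow> 'q approximation \<Rightarrow> 'q \<Rightarrow> nat \<Rightarrow> nat set set" where
  "late_values le K q n = {D. \<exists>r k. (r, k, D) \<in> K \<and> (r, q) \<in> le \<and> n < k}"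

definition frequent :: "'q rel \<Rightarrow> 'q approximation \<Rightarrow> 'q \<Rightarrow> bool" where
  "frequent le K q \<longleftrightarrow> (\<forall>q' n. (q', q) \<in> le \<longrightarrow> late_values le K q' n \<noteq> {})"

definition hitting :: "nat set set \<Rightarrow> 'q approximation \<Rightarrow> 'q approximation" where
  "hitting F K = {(r, k, D) \<in> K. \<forall>b\<in>F. D \<inter> b \<noteq> {}}"

definition settles :: "'q rel \<Rightarrow> 'q approximation \<Rightarrow> nat set \<Rightarrow> 'q \<Rightarrow> bool" where
  "settles le K b q \<longleftrightarrow>
     (\<exists>N. (\<forall>D\<in>late_values le K q N. D \<inter> b \<noteq> {}) \<or> (\<forall>D\<in>late_values le K q N. D \<inter> b = {}))"

definition downward :: "'q rel \<Rightarrow> 'q approximation \<Rightarrow> bool" where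
  "downward le K \<longleftrightarrow> (\<forall>s k D r. (s, k, D) \<in> K \<longrightarrow> (r, s) \<in> le \<longrightarrow> (r, k, D) \<in> K)"

definition approximates :: "'q set \<Rightarrow> 'q rel \<Rightarrow> 'q approximation \<Rightarrow> bool" where
  "approximates Q le K \<longleftrightarrow> K \<subseteq> Q \<times> UNIV \<times> {D. finite D \<and> D \<noteq> {}} \<and> downward le K \<and>
     (\<forall>s k D s' k' D'. (s, k, D) \<in> K \<longrightarrow> (s', k', D') \<in> K \<longrightarrow> (s', s) \<in> le \<longrightarrow> D \<inter> D' \<noteq> {} \<longrightarrow> k = k')"

text \<open>
  In an extension whose generic filter contains \<open>q\<close>, the first clauses make the infinite
  traces of members of \<open>A\<close> on the index set of \<open>K'\<close> centered: the traces of members of \<open>S\<close>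
  have infinite finite intersections, and every other trace is finite or cofinite.
  The last clause serves maximality: when the terms of the sequence are singletons, it
  provides a member of \<open>A\<close> that has infinite intersection with their union.
\<close>

definition captures ::
    "'q rel \<Rightarrow> nat set set \<Rightarrow> 'q approximation \<Rightarrow> 'q \<Rightarrow> 'q approximation \<Rightarrow> nat set set \<Rightarrow> bool" where
  "captures le A K q K' S \<longleftrightarrow> K' \<subseteq> K \<and> downward le K' \<and> S \<subseteq> A \<and>
     (\<forall>F\<subseteq>S. finite F \<longrightarrow> frequent le (hitting F K') q) \<and>
     (\<forall>b\<in>A - S. \<forall>r. (r, q) \<in> le \<longrightarrow> (\<exists>r'. (r', r) \<in> le \<and> settles le K' b r')) \<and>
     (\<exists>a\<in>A. frequent le (hitting {a} K') q)"

text \<open>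
  This is the property to be achieved by the construction.  It mentions neither names
  nor the forcing relation, and it yields both maximality and the fin-intersecting
  property in the extension.
\<close>

definition absorbing :: "'q set \<Rightarrow> 'q rel \<Rightarrow> nat set set \<Rightarrow> bool" where
  "absorbing Q le A \<longleftrightarrow> (\<forall>q\<in>Q. \<forall>K. approximates Q le K \<longrightarrow> frequent le K q \<longrightarrow>
     (\<exists>q' K' S. (q', q) \<in> le \<and> captures le A K q' K' S))"

lemma capturesD:
  assumes "captures le A K q K' S"
  shows "K' \<subseteq> K" "downward le K'" "S \<subseteq> A"
    "\<And>F. F \<subseteq> S \<Longrightarrow> finite F \<Longrightarrow> frequent le (hitting F K') q"
    "\<And>b r. b \<in> A \<Longrightarrow> b \<notin> S \<Longrightarrow> (r, q) \<in> le \<Longrightarrow> \<exists>r'. (r', r) \<in> le \<and> settles le K' b r'"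
    "\<exists>a\<in>A. frequent le (hitting {a} K') q"
  using assms unfolding captures_def by (elim conjE, simp)+

lemma absorbingD:
  assumes "absorbing Q le A" "q \<in> Q" "approximates Q le K" "frequent le K q"
  shows "\<exists>q' K' S. (q', q) \<in> le \<and> captures le A K q' K' S"
  using assms unfolding absorbing_def by simp

lemma late_values_mono: "K' \<subseteq> K \<Longrightarrow> n' \<ge> n \<Longrightarrow> late_values le K' q n' \<subseteq> late_values le K q n"
  unfolding late_values_def by force

lemma hitting_subset: "hitting F K \<subseteq> K"
  unfolding hitting_def by auto

lemma downward_empty: "downward le {}"
  unfolding downward_def by simp

lemma downward_hitting: "downward le K \<Longrightarrow> downward le (hitting F K)"
  unfolding hitting_def downward_def by auto

lemma hitting_empty [simp]: "hitting {} K = K"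
  unfolding hitting_def by auto

locale conditions =
  fixes Q :: "'q set" and le :: "'q rel"
  assumes preordered: "preorder_on Q le"
begin

lemma le_in: "(q, p) \<in> le \<Longrightarrow> q \<in> Q" "(q, p) \<in> le \<Longrightarrow> p \<in> Q"
  using preordered unfolding preorder_on_def by auto

lemma le_refl: "p \<in> Q \<Longrightarrow> (p, p) \<in> le"
  using preordered unfolding preorder_on_def refl_on_def by auto

lemma le_trans: "(r, q) \<in> le \<Longrightarrow> (q, p) \<in> le \<Longrightarrow> (r, p) \<in> le"
  using preordered unfolding preorder_on_def trans_def by blast

lemma late_values_below: "(q', q) \<in> le \<Longrightarrow> late_values le K q' n \<subseteq> late_values le K q n"
  unfolding late_values_def using le_trans by blast

lemma frequent_below: "frequent le K q \<Longrightarrow> (q', q) \<in> le \<Longrightarrow> frequent le K q'"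
  unfolding frequent_def using le_trans by blast

lemma settles_below: "settles le K b q \<Longrightarrow> (q', q) \<in> le \<Longrightarrow> settles le K b q'"
  unfolding settles_def using late_values_below[of q' q K] by (meson subset_iff)

end

locale countable_preorder = conditions Q le for Q :: "'q set" and le :: "'q rel" +
  assumes countable_Q: "countable Q"
begin

section \<open>Settling countably many traces\<close>

text \<open>
  In the extension: if infinitely many terms meet \<open>b\<close>, keep exactly those terms, otherwise
  discard them.  In the ground model the case distinction can only be made below
  conditions that decide which case holds, and those are dense.
\<close>

lemma ex_settling_subset_single:
  assumes "downward le K"
  obtains K' where "K' \<subseteq> K" "downward le K'" "\<And>q. frequent le K q \<Longrightarrow> frequent le K' q"
    "\<And>q. q \<in> Q \<Longrightarrow> \<exists>r. (r, q) \<in> le \<and> settles le K' b r"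
proof -
  define H where "H = hitting {b} K"
  \<comment> \<open>Where \<open>r\<close> decides neither case, no triple is kept; \<open>frequent le K' q\<close> survives because
    the deciding conditions are dense.\<close>
  define K' where "K' = {(r, k, D) \<in> K. if frequent le H r then D \<inter> b \<noteq> {}
      else D \<inter> b = {} \<and> (\<forall>r'. (r', r) \<in> le \<longrightarrow> \<not> frequent le H r')}"
  show ?thesis
  proof
    show "K' \<subseteq> K" unfolding K'_def by auto
    show "downward le K'"
      unfolding downward_def
    proof (intro allI impI)
      fix s k D r assume s: "(s, k, D) \<in> K'" and r: "(r, s) \<in> le"
      have "(r, k, D) \<in> K" using s r assms unfolding K'_def downward_def by auto
      moreover have "\<forall>r'. (r', r) \<in> le \<longrightarrow> (r', s) \<in> le" using r le_trans by blast
      ultimately show "(r, k, D) \<in> K'"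
        using s r frequent_below[of H s r] unfolding K'_def by (auto split: if_splits)
    qed
  next
    fix q assume fr: "frequent le K q"
    show "frequent le K' q"
      unfolding frequent_def
    proof (intro allI impI)
      fix q' n assume q': "(q', q) \<in> le"
      show "late_values le K' q' n \<noteq> {}"
      proof (cases "\<exists>r. (r, q') \<in> le \<and> frequent le H r")
        case True
        then obtain r where r: "(r, q') \<in> le" "frequent le H r" by blast
        then obtain s k D where s: "(s, k, D) \<in> H" "(s, r) \<in> le" "n < k"
          unfolding frequent_def late_values_def using le_refl le_in by blast
        then have "(s, k, D) \<in> K'"
          using frequent_below[OF r(2) s(2)] unfolding K'_def H_def hitting_def by auto
        then show ?thesis
          using s r le_trans unfolding late_values_def by blast
      next
        case False
        then have "\<not> frequent le H q'" using q' le_refl le_in by blast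
        then obtain r m where r: "(r, q') \<in> le" "late_values le H r m = {}"
          unfolding frequent_def by blast
        have "late_values le K r (max n m) \<noteq> {}"
          using fr r(1) q' le_trans unfolding frequent_def by blast
        then obtain s k D where s: "(s, k, D) \<in> K" "(s, r) \<in> le" "n < k" "m < k"
          unfolding late_values_def by auto
        have "(s, k, D) \<notin> H"
          using r(2) s unfolding late_values_def by blast
        then have "D \<inter> b = {}"
          using s(1) unfolding H_def hitting_def by auto
        moreover have "\<forall>r'. (r', s) \<in> le \<longrightarrow> \<not> frequent le H r'"
          using False r(1) s(2) le_trans by blast
        moreover have "\<not> frequent le H s"
          using calculation(2) s(2) le_refl le_in by blast
        ultimately have "(s, k, D) \<in> K'"
          unfolding K'_def using s(1) by auto
        then show ?thesis
          using s r le_trans unfolding late_values_def by blast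
      qed
    qed
  next
    fix q assume q: "q \<in> Q"
    show "\<exists>r. (r, q) \<in> le \<and> settles le K' b r"
    proof (cases "\<exists>r. (r, q) \<in> le \<and> frequent le H r")
      case True
      then obtain r where r: "(r, q) \<in> le" "frequent le H r" by blast
      have "\<forall>D\<in>late_values le K' r 0. D \<inter> b \<noteq> {}"
        unfolding late_values_def K'_def using frequent_below[OF r(2)] by auto
      then show ?thesis using r(1) unfolding settles_def by blast
    next
      case False
      have "\<forall>D\<in>late_values le K' q 0. D \<inter> b = {}"
        using False unfolding late_values_def K'_def by auto
      then show ?thesis using le_refl[OF q] unfolding settles_def by blast
    qed
  qed
qed

text \<open>
  The counterpart in the ground model of choosing a pseudo-intersection.  Settling the
  members \<open>e 0, e 1, \<dots>\<close> of \<open>A\<close> one after the other gives a decreasing sequence \<open>Ks\<close>.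
  The \<open>j\<close>-th of the countably many requests ``an index beyond \<open>n\<close>, below \<open>q\<close>'' is met by a
  triple \<open>s j\<close> from \<open>Ks j\<close>; so for every \<open>i\<close> all but finitely many of the selected
  triples come from \<open>Ks (Suc i)\<close>, where \<open>e i\<close> is settled.
\<close>

lemma ex_settling_subset:
  assumes "countable A" "downward le K"
  obtains K' where "K' \<subseteq> K" "downward le K'" "\<And>q. frequent le K q \<Longrightarrow> q \<in> Q \<Longrightarrow> frequent le K' q"
    "\<And>b q. b \<in> A \<Longrightarrow> q \<in> Q \<Longrightarrow> \<exists>r. (r, q) \<in> le \<and> settles le K' b r"
proof -
  define T where "T = {(q, n :: nat). q \<in> Q \<and> frequent le K q}"
  show ?thesis
  proof (cases "T = {}")
    case True
    show ?thesis
    proof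
      show "{} \<subseteq> K" by simp
      show "downward le {}" by (rule downward_empty)
      show "frequent le {} q" if "frequent le K q" "q \<in> Q" for q
        using that True unfolding T_def by auto
      show "\<exists>r. (r, q) \<in> le \<and> settles le {} b r" if "b \<in> A" "q \<in> Q" for b q
        using le_refl[OF that(2)] unfolding settles_def late_values_def by auto
    qed
  next
    case nonempty: False
    have "T \<subseteq> Q \<times> UNIV" unfolding T_def by auto
    then have "countable T"
      using countable_Q by (meson countable_SIGMA countable_subset uncountable_def countableI_type)
    define t where "t = from_nat_into T"
    have t: "range t = T"
      unfolding t_def using nonempty \<open>countable T\<close> by simp
    define e where "e = from_nat_into A"
    have e: "A \<subseteq> range e"
      unfolding e_def using assms(1) by (rule subset_range_from_nat_into)
    \<comment> \<open>A choice function, since \<open>Ks\<close> is defined by iterating the previous lemma.\<close>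
    define \<phi> where "\<phi> b K = (SOME K'. K' \<subseteq> K \<and> downward le K' \<and>
        (\<forall>q. frequent le K q \<longrightarrow> frequent le K' q) \<and>
        (\<forall>q\<in>Q. \<exists>r. (r, q) \<in> le \<and> settles le K' b r))" for b K
    have "\<phi> b K \<subseteq> K \<and> downward le (\<phi> b K) \<and>
        (\<forall>q. frequent le K q \<longrightarrow> frequent le (\<phi> b K) q) \<and>
        (\<forall>q\<in>Q. \<exists>r. (r, q) \<in> le \<and> settles le (\<phi> b K) b r)" if "downward le K" for b K
      unfolding \<phi>_def by (rule someI_ex, rule ex_settling_subset_single[OF that, of b]) blast
    then have \<phi>: "\<And>b K. downward le K \<Longrightarrow> \<phi> b K \<subseteq> K"
        "\<And>b K. downward le K \<Longrightarrow> downward le (\<phi> b K)"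
        "\<And>b K q. downward le K \<Longrightarrow> frequent le K q \<Longrightarrow> frequent le (\<phi> b K) q"
        "\<And>b K q. downward le K \<Longrightarrow> q \<in> Q \<Longrightarrow> \<exists>r. (r, q) \<in> le \<and> settles le (\<phi> b K) b r"
      by blast+
    define Ks where "Ks = rec_nat K (\<lambda>n. \<phi> (e n))"
    have Ks: "Ks 0 = K" "\<And>n. Ks (Suc n) = \<phi> (e n) (Ks n)"
      unfolding Ks_def by auto
    have down: "downward le (Ks n)" for n
      by (induction n) (simp_all add: Ks assms(2) \<phi>(2))
    have anti: "Ks n \<subseteq> Ks m" if "m \<le> n" for m n
      by (rule lift_Suc_antimono_le[OF _ that]) (simp add: Ks \<phi>(1) down)
    have fr: "frequent le (Ks n) q" if "frequent le K q" for n q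
      using that by (induction n) (simp_all add: Ks \<phi>(3) down)
    \<comment> \<open>Indices beyond \<open>j\<close> make every index occur for finitely many \<open>j\<close> only.\<close>
    have "\<exists>s. \<forall>j. s j \<in> Ks j \<and> (fst (s j), fst (t j)) \<in> le \<and> max (snd (t j)) j < fst (snd (s j))"
    proof (rule choice, rule)
      fix j
      have "t j \<in> T" using t by auto
      then have "fst (t j) \<in> Q" "frequent le K (fst (t j))" unfolding T_def by auto
      then have "late_values le (Ks j) (fst (t j)) (max (snd (t j)) j) \<noteq> {}"
        using fr le_refl unfolding frequent_def by blast
      then show "\<exists>s. s \<in> Ks j \<and> (fst s, fst (t j)) \<in> le \<and> max (snd (t j)) j < fst (snd s)"
        unfolding late_values_def by auto
    qed
    then obtain s where s: "\<And>j. s j \<in> Ks j" "\<And>j. (fst (s j), fst (t j)) \<in> le"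
        "\<And>j. snd (t j) < fst (snd (s j))" "\<And>j. j < fst (snd (s j))"
      by (metis max_less_iff_conj)
    \<comment> \<open>The downward closure of the range of \<open>s\<close>.\<close>
    define K' where "K' = {(r, k, D). \<exists>j. (r, fst (s j)) \<in> le \<and> snd (s j) = (k, D)}"
    have s_in: "(r, k, D) \<in> Ks j" if "(r, fst (s j)) \<in> le" "snd (s j) = (k, D)" for r k D j
      using down[of j] s(1)[of j] that unfolding downward_def by (metis prod.collapse)
    show ?thesis
    proof
      show "K' \<subseteq> K" using s_in anti[of 0] Ks(1) unfolding K'_def by fastforce
      show "downward le K'" unfolding downward_def K'_def using le_trans by blast
    next
      fix q assume q: "frequent le K q" "q \<in> Q"
      show "frequent le K' q"
        unfolding frequent_def
      proof (intro allI impI)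
        fix q' n assume "(q', q) \<in> le"
        then have "(q', n) \<in> T" unfolding T_def using frequent_below[OF q(1)] le_in by auto
        then obtain j where j: "t j = (q', n)" using t by (metis imageE)
        obtain p k D where sj: "s j = (p, k, D)" using prod_cases3 by blast
        have "(p, k, D) \<in> K'"
          unfolding K'_def using sj le_refl[OF le_in(1)[OF s(2)[of j]]] by (auto intro!: exI[of _ j])
        then have "D \<in> late_values le K' q' n"
          unfolding late_values_def using s(2,3)[of j] j sj by auto
        then show "late_values le K' q' n \<noteq> {}" by auto
      qed
    next
      fix b q assume "b \<in> A" and q: "q \<in> Q"
      then obtain i where i: "b = e i" using e by blast
      obtain r N where r: "(r, q) \<in> le" and
        N: "(\<forall>D\<in>late_values le (Ks (Suc i)) r N. D \<inter> b \<noteq> {}) \<or> (\<forall>D\<in>late_values le (Ks (Suc i)) r N. D \<inter> b = {})"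
        using \<phi>(4)[OF down[of i] q, of "e i"] unfolding Ks(2)[symmetric] i settles_def by (elim exE conjE)
      obtain M where M: "\<And>j. j \<le> i \<Longrightarrow> fst (snd (s j)) \<le> M"
        using finite_nat_set_iff_bounded_le[of "(\<lambda>j. fst (snd (s j))) ` {..i}"] by auto
      have "late_values le K' r (max N M) \<subseteq> late_values le (Ks (Suc i)) r N"
      proof
        fix D assume "D \<in> late_values le K' r (max N M)"
        then obtain p k j where j: "(p, fst (s j)) \<in> le" "snd (s j) = (k, D)" "(p, r) \<in> le" "N < k" "M < k"
          unfolding late_values_def K'_def by auto
        then have "Suc i \<le> j" using M[of j] by (cases "j \<le> i") auto
        then have "(p, k, D) \<in> Ks (Suc i)" using s_in[OF j(1,2)] anti by blast
        then show "D \<in> late_values le (Ks (Suc i)) r N"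
          unfolding late_values_def using j by blast
      qed
      then have "settles le K' b r"
        using N unfolding settles_def by (meson subset_iff)
      then show "\<exists>r. (r, q) \<in> le \<and> settles le K' b r" using r by blast
    qed
  qed
qed

end

section \<open>One step of the construction\<close>

text \<open>
  A member of \<open>B\<close> outside \<open>F\<close> has finite intersection with \<open>\<Union>F\<close>, so almost
  all of it lies outside.  Hence a new member of the family can be required to meet all cofinite sets,
  which makes it infinite.
\<close>

lemma almost_disjoint_not_covered:
  assumes "infinite B" "\<And>b. b \<in> B \<Longrightarrow> infinite b" "finite F" "finite E"
    and "\<And>b c. b \<in> B \<Longrightarrow> c \<in> F \<Longrightarrow> b \<noteq> c \<Longrightarrow> finite (b \<inter> c)"
  shows "\<not> - E \<subseteq> \<Union>F"
proof
  assume cov: "- E \<subseteq> \<Union>F"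
  obtain b where b: "b \<in> B" "b \<notin> F"
    using assms(1,3) by (meson finite_subset subsetI)
  have "b \<subseteq> E \<union> (\<Union>c\<in>F. b \<inter> c)" using cov by blast
  moreover have "finite (E \<union> (\<Union>c\<in>F. b \<inter> c))"
    using assms b by (intro finite_UnI finite_UN_I) auto
  ultimately show False using assms(2)[OF b(1)] finite_subset by blast
qed

lemma ex_max_of_total:
  assumes "total R" "trans R" "finite G" "G \<noteq> {}"
  obtains m where "m \<in> G" "\<And>x. x \<in> G \<Longrightarrow> x \<noteq> m \<Longrightarrow> (x, m) \<in> R"
proof -
  from assms(3,4) have "\<exists>m\<in>G. \<forall>x\<in>G. x \<noteq> m \<longrightarrow> (x, m) \<in> R"
  proof (induction rule: finite_ne_induct)
    case (singleton x) then show ?case by auto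
  next
    case (insert x G)
    then obtain m where m: "m \<in> G" "\<And>y. y \<in> G \<Longrightarrow> y \<noteq> m \<Longrightarrow> (y, m) \<in> R" by blast
    have "x \<noteq> m" using insert m by auto
    then consider "(x, m) \<in> R" | "(m, x) \<in> R"
      using assms(1) unfolding total_on_def by blast
    then show ?case
    proof cases
      case 1 then show ?thesis using m by auto
    next
      case 2
      have "(y, x) \<in> R" if "y \<in> G" "y \<noteq> x" for y
        using m(2)[OF that(1)] 2 transD[OF assms(2)] by (cases "y = m") auto
      then show ?thesis by auto
    qed
  qed
  then show ?thesis using that by blast
qed

text \<open>
  Subsets of \<open>\<omega>\<close> serve as indices of the stages of the construction.  Over a countable set of
  conditions there are countably many triples, so every approximation is coded by
  a subset of \<open>\<omega>\<close>.  Where the coded set is not downward closed, \<open>{}\<close> takes its place, so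
  that every stage treats a downward closed set.
\<close>

definition decode :: "'q set \<Rightarrow> 'q rel \<Rightarrow> nat set \<Rightarrow> 'q approximation" where
  "decode Q le i =
     (let K = {u \<in> Q \<times> UNIV \<times> {D. finite D}. to_nat_on (Q \<times> UNIV \<times> {D. finite D}) u \<in> i}
      in if downward le K then K else {})"

lemma downward_decode: "downward le (decode Q le i)"
  unfolding decode_def Let_def by (simp add: downward_empty)

context countable_preorder
begin

lemma decode_surj:
  assumes "approximates Q le K"
  obtains i where "decode Q le i = K"
proof
  let ?U = "Q \<times> (UNIV :: nat set) \<times> {D :: nat set. finite D}"
  have "countable ?U"
    using countable_Q by (intro countable_SIGMA) (simp_all add: countable_Collect_finite)
  then have "inj_on (to_nat_on ?U) ?U" by (rule inj_on_to_nat_on)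
  moreover have "K \<subseteq> ?U" using assms unfolding approximates_def by blast
  ultimately have "{u \<in> ?U. to_nat_on ?U u \<in> to_nat_on ?U ` K} = K"
    using inj_on_image_mem_iff[of "to_nat_on ?U" ?U _ K] by blast
  moreover have "downward le K" using assms unfolding approximates_def by blast
  ultimately show "decode Q le (to_nat_on ?U ` K) = K"
    unfolding decode_def by (simp only: Let_def if_True)
qed

text \<open>
  \<open>A\<close> is the family built so far, \<open>\<K>\<close> contains the approximations \<open>L\<close> fixed at earlier
  stages, and \<open>K\<close> is the approximation to be treated now.  The last clause concerns
  the members of \<open>F\<close>, which may have been added after \<open>L\<close> was fixed: if the terms met by all
  of them are not covered by finitely many members of \<open>A\<close>, then \<open>a\<close> joins them in
  meeting one of these terms.
\<close>

definition next_stage ::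
    "nat set set \<Rightarrow> 'q approximation set \<Rightarrow> 'q approximation \<Rightarrow> nat set \<Rightarrow> 'q approximation \<Rightarrow> bool" where
  "next_stage A \<K> K a K' \<longleftrightarrow>
     infinite a \<and> (\<forall>b\<in>A. finite (a \<inter> b)) \<and> K' \<subseteq> K \<and> downward le K' \<and>
     (\<forall>q\<in>Q. frequent le K q \<longrightarrow> frequent le K' q) \<and>
     (\<forall>b\<in>insert a A. \<forall>q\<in>Q. \<exists>r. (r, q) \<in> le \<and> settles le K' b r) \<and>
     (\<forall>L\<in>\<K>. \<forall>F\<subseteq>A. finite F \<longrightarrow> (\<forall>q\<in>Q. \<forall>n.
        (\<exists>F'\<subseteq>A. finite F' \<and> \<Union>(late_values le (hitting F L) q n) \<subseteq> \<Union>F') \<or>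
        late_values le (hitting (insert a F) L) q n \<noteq> {}))"

lemma next_stage_exists:
  assumes "countable A" "A \<noteq> {}" "countable \<K>" "downward le K"
    and unc: "\<And>F E. F \<subseteq> A \<Longrightarrow> finite F \<Longrightarrow> finite E \<Longrightarrow> \<not> - E \<subseteq> \<Union>F"
  shows "\<exists>a K'. next_stage A \<K> K a K'"
proof -
  define \<F> where "\<F> = {F. F \<subseteq> A \<and> finite F}"
  have \<F>: "countable \<F>"
    unfolding \<F>_def using countable_Collect_finite_subset[OF assms(1)] by (simp add: conj_commute)
  \<comment> \<open>The demands of the earlier stages are kept when they can be met; the cofinite sets
    are added to make \<open>a\<close> infinite.\<close>
  define w where "w = (\<lambda>(L, F, q, n). \<Union>(late_values le (hitting F L) q n))"
  define \<W> where "\<W> = {W \<in> w ` (\<K> \<times> \<F> \<times> Q \<times> UNIV). \<not> (\<exists>F'\<in>\<F>. W \<subseteq> \<Union>F')} \<union> range (\<lambda>n. - {..n})"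
  have "countable \<W>"
    unfolding \<W>_def using assms(3) \<F> countable_Q
    by (intro countable_Un countable_subset[OF Collect_restrict] countable_image countable_SIGMA) auto
  moreover have "\<W> \<noteq> {}" unfolding \<W>_def by blast
  moreover have "\<not> {n<..} \<subseteq> \<Union>F" if "finite F" "F \<subseteq> A" for F n
    using unc[of F "{..n}"] that by simp
  then have "\<not> W \<subseteq> \<Union>F" if "W \<in> \<W>" "finite F" "F \<subseteq> A" for W F
    using that unfolding \<W>_def \<F>_def by auto
  ultimately have "\<exists>a. (\<forall>b\<in>A. finite (a \<inter> b)) \<and> (\<forall>W\<in>\<W>. a \<inter> W \<noteq> {})"
    by (rule ex_almost_disjoint_meeting[OF assms(1,2)])
  then obtain a where a': "\<forall>b\<in>A. finite (a \<inter> b)" "\<forall>W\<in>\<W>. a \<inter> W \<noteq> {}"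
    by (elim exE conjE)
  note a = a'[rule_format]
  have inf: "infinite a"
    unfolding infinite_nat_iff_unbounded
  proof
    fix n
    have "a \<inter> - {..n} \<noteq> {}" using a(2) unfolding \<W>_def by blast
    then show "\<exists>m>n. m \<in> a" by auto
  qed
  obtain K' where K': "K' \<subseteq> K" "downward le K'" "\<And>q. frequent le K q \<Longrightarrow> q \<in> Q \<Longrightarrow> frequent le K' q"
    "\<And>b q. b \<in> insert a A \<Longrightarrow> q \<in> Q \<Longrightarrow> \<exists>r. (r, q) \<in> le \<and> settles le K' b r"
    using ex_settling_subset[of "insert a A" K] assms(1,4) by (metis countable_insert)
  have "(\<exists>F'\<subseteq>A. finite F' \<and> \<Union>(late_values le (hitting F L) q n) \<subseteq> \<Union>F') \<or>
        late_values le (hitting (insert a F) L) q n \<noteq> {}"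
    if "L \<in> \<K>" "F \<subseteq> A" "finite F" "q \<in> Q" for L F q n
  proof (cases "\<exists>F'\<subseteq>A. finite F' \<and> \<Union>(late_values le (hitting F L) q n) \<subseteq> \<Union>F'")
    case True
    then show ?thesis by blast
  next
    case False
    then have "\<not> (\<exists>F'\<in>\<F>. w (L, F, q, n) \<subseteq> \<Union>F')"
      unfolding \<F>_def w_def by auto
    moreover have "w (L, F, q, n) \<in> w ` (\<K> \<times> \<F> \<times> Q \<times> UNIV)"
      using that unfolding \<F>_def by simp
    ultimately have "w (L, F, q, n) \<in> \<W>"
      unfolding \<W>_def by blast
    then have "a \<inter> w (L, F, q, n) \<noteq> {}" by (rule a(2))
    then obtain D where "D \<in> late_values le (hitting F L) q n" "a \<inter> D \<noteq> {}"
      unfolding w_def by auto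
    then have "D \<in> late_values le (hitting (insert a F) L) q n"
      unfolding late_values_def hitting_def by (auto simp: Int_commute)
    then show ?thesis by blast
  qed
  then have "next_stage A \<K> K a K'"
    unfolding next_stage_def by (intro conjI ballI allI impI) (use a(1) inf K' in \<open>simp_all\<close>)
  then show ?thesis by blast
qed

end

section \<open>The construction of length \<open>\<omega>\<^sub>1\<close>\<close>

lemma settles_uniformly:
  assumes "finite F" "\<forall>b\<in>F. settles le K b q"
  shows "\<exists>N. \<forall>b\<in>F. (\<forall>D\<in>late_values le K q N. D \<inter> b \<noteq> {}) \<or> (\<forall>D\<in>late_values le K q N. D \<inter> b = {})"
  using assms
proof (induction F rule: finite_induct)
  case empty then show ?case by simp
next
  case (insert c F)
  then obtain N where N: "\<forall>b\<in>F. (\<forall>D\<in>late_values le K q N. D \<inter> b \<noteq> {}) \<or> (\<forall>D\<in>late_values le K q N. D \<inter> b = {})"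
    by auto
  obtain M where M: "(\<forall>D\<in>late_values le K q M. D \<inter> c \<noteq> {}) \<or> (\<forall>D\<in>late_values le K q M. D \<inter> c = {})"
    using insert.prems unfolding settles_def by auto
  have sub: "late_values le K q (max N M) \<subseteq> late_values le K q N" "late_values le K q (max N M) \<subseteq> late_values le K q M"
    by (simp_all add: late_values_mono)
  have "\<forall>b\<in>insert c F. (\<forall>D\<in>late_values le K q (max N M). D \<inter> b \<noteq> {}) \<or> (\<forall>D\<in>late_values le K q (max N M). D \<inter> b = {})"
  proof
    fix b assume "b \<in> insert c F"
    then show "(\<forall>D\<in>late_values le K q (max N M). D \<inter> b \<noteq> {}) \<or> (\<forall>D\<in>late_values le K q (max N M). D \<inter> b = {})"
      using N M sub by (metis insert_iff subsetD)
  qed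
  then show ?case by blast
qed

context countable_preorder
begin

text \<open>
  Being settled is inherited by stronger conditions, so finitely many sets can be treated
  in turn.
\<close>

lemma settle_finitely_many:
  assumes "finite F" "r \<in> Q"
    "\<And>b r. b \<in> F \<Longrightarrow> r \<in> Q \<Longrightarrow> \<exists>r'. (r', r) \<in> le \<and> settles le K b r'"
  shows "\<exists>r'. (r', r) \<in> le \<and> (\<forall>b\<in>F. settles le K b r')"
  using assms(1,3)
proof (induction F rule: finite_induct)
  case empty then show ?case using le_refl[OF assms(2)] by auto
next
  case (insert b F)
  then obtain r1 where r1: "(r1, r) \<in> le" "\<forall>b\<in>F. settles le K b r1" by auto
  then obtain r2 where r2: "(r2, r1) \<in> le" "settles le K b r2"
    using insert.prems[of b r1] le_in by blast
  then have "\<forall>b\<in>insert b F. settles le K b r2"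
    using r1(2) settles_below by blast
  then show ?case using le_trans r1(1) r2(1) by blast
qed

text \<open>
  The terms of the sequence are pairwise disjoint, so a point belongs to at most one of
  them; it suffices to pass to a condition that decides to which one, if any.
\<close>

lemma avoid_finite_set:
  assumes K: "approximates Q le K" and "finite X" "r \<in> Q"
  shows "\<exists>r' N. (r', r) \<in> le \<and> (\<forall>D\<in>late_values le K r' N. D \<inter> X = {})"
  using assms(2)
proof (induction X rule: finite_induct)
  case empty then show ?case using le_refl[OF assms(3)] by auto
next
  case (insert x X)
  then obtain r1 N where r1: "(r1, r) \<in> le" "\<forall>D\<in>late_values le K r1 N. D \<inter> X = {}" by auto
  have "\<exists>r2 M. (r2, r1) \<in> le \<and> (\<forall>D\<in>late_values le K r2 M. x \<notin> D)"
  proof (cases "\<exists>s k D. (s, k, D) \<in> K \<and> (s, r1) \<in> le \<and> x \<in> D")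
    case True
    then obtain s k D where s: "(s, k, D) \<in> K" "(s, r1) \<in> le" "x \<in> D" by blast
    have "k' = k" if "(s', k', D') \<in> K" "(s', s) \<in> le" "x \<in> D'" for s' k' D'
      using K s that unfolding approximates_def by blast
    then have "\<forall>D'\<in>late_values le K s k. x \<notin> D'"
      unfolding late_values_def by blast
    then show ?thesis using s(2) by blast
  next
    case False
    then have "\<forall>D\<in>late_values le K r1 0. x \<notin> D" unfolding late_values_def by blast
    then show ?thesis using le_refl le_in(1)[OF r1(1)] by blast
  qed
  then obtain r2 M where r2: "(r2, r1) \<in> le" "\<forall>D\<in>late_values le K r2 M. x \<notin> D" by blast
  have "\<forall>D\<in>late_values le K r2 (max N M). D \<inter> insert x X = {}"
  proof
    fix D assume "D \<in> late_values le K r2 (max N M)"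
    then have "D \<in> late_values le K r1 N" "D \<in> late_values le K r2 M"
      using late_values_below[OF r2(1), of K N] late_values_mono[of K K N "max N M" le r2]
        late_values_mono[of K K M "max N M" le r2] by auto
    then show "D \<inter> insert x X = {}" using r1(2) r2(2) by blast
  qed
  then show ?case using r1(1) r2(1) le_trans by blast
qed

text \<open>
  If all late terms lie in the union of a finite \<open>F \<subseteq> A\<close>, then a member of \<open>A\<close> outside
  \<open>F\<close> meets \<open>\<Union>F\<close> in a finite set and hence only finitely many terms.  The members of \<open>F\<close>
  are settled by shrinking once more.  As the terms are nonempty and covered by \<open>F\<close>, some
  member of \<open>F\<close> must be settled positively.
\<close>

lemma ex_settling_subset_if_covered:
  assumes K: "approximates Q le K" and q: "q \<in> Q" and fr: "frequent le K q"
    and F: "finite F" "F \<subseteq> A" and cov: "\<Union>(late_values le K q n) \<subseteq> \<Union>F"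
    and ad: "\<And>a b. a \<in> A \<Longrightarrow> b \<in> A \<Longrightarrow> a \<noteq> b \<Longrightarrow> finite (a \<inter> b)"
  shows "\<exists>q1 K1. (q1, q) \<in> le \<and> K1 \<subseteq> K \<and> downward le K1 \<and> frequent le K1 q1 \<and>
    (\<forall>b\<in>A. \<forall>r. (r, q1) \<in> le \<longrightarrow> (\<exists>r'. (r', r) \<in> le \<and> settles le K1 b r')) \<and>
    (\<exists>a\<in>A. frequent le (hitting {a} K1) q1)"
proof -
  have "downward le K" using K unfolding approximates_def by blast
  then obtain K1 where K1: "K1 \<subseteq> K" "\<And>q. frequent le K q \<Longrightarrow> q \<in> Q \<Longrightarrow> frequent le K1 q"
    "\<And>b q. b \<in> F \<Longrightarrow> q \<in> Q \<Longrightarrow> \<exists>r. (r, q) \<in> le \<and> settles le K1 b r" "downward le K1"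
    using ex_settling_subset[of F K] F(1) countable_finite by metis
  obtain q1 where q1: "(q1, q) \<in> le" "\<And>b. b \<in> F \<Longrightarrow> settles le K1 b q1"
    using settle_finitely_many[OF F(1) q K1(3)] by blast
  have fr1: "frequent le K1 q1" using K1(2) fr q q1(1) frequent_below by blast
  have ex: "\<exists>r'. (r', r) \<in> le \<and> settles le K1 b r'" if b: "b \<in> A" and r: "(r, q1) \<in> le" for b r
  proof (cases "b \<in> F")
    case True then show ?thesis using K1(3) r le_in by blast
  next
    case False
    have "finite (\<Union>c\<in>F. b \<inter> c)"
    proof (intro finite_UN_I)
      show "finite (b \<inter> c)" if "c \<in> F" for c
        using that F(2) b False by (intro ad) auto
    qed (rule F(1))
    then have "finite (b \<inter> \<Union>F)" by (simp only: Int_Union)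
    then obtain r' N where r': "(r', r) \<in> le" "\<forall>D\<in>late_values le K r' N. D \<inter> (b \<inter> \<Union>F) = {}"
      using avoid_finite_set[OF K] r le_in by meson
    have "(r', q) \<in> le" using le_trans[OF r'(1) le_trans[OF r q1(1)]] .
    have "D \<inter> b = {}" if D: "D \<in> late_values le K1 r' (max N n)" for D
    proof -
      have "D \<in> late_values le K r' N" using D late_values_mono[OF K1(1), of N "max N n" le r'] by auto
      moreover have "D \<in> late_values le K q n"
        using D late_values_mono[OF K1(1), of n "max N n" le r'] late_values_below[OF \<open>(r', q) \<in> le\<close>, of K n] by auto
      then have "D \<subseteq> \<Union>F" using cov by blast
      moreover have "D \<inter> (b \<inter> \<Union>F) = {}" using r'(2) calculation(1) by blast
      ultimately show ?thesis by blast
    qed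
    then show ?thesis using r'(1) unfolding settles_def by blast
  qed
  have "\<exists>N. \<forall>b\<in>F. (\<forall>D\<in>late_values le K1 q1 N. D \<inter> b \<noteq> {}) \<or> (\<forall>D\<in>late_values le K1 q1 N. D \<inter> b = {})"
    by (rule settles_uniformly[OF F(1)]) (intro ballI q1(2))
  then obtain N where N: "\<forall>b\<in>F. (\<forall>D\<in>late_values le K1 q1 N. D \<inter> b \<noteq> {}) \<or> (\<forall>D\<in>late_values le K1 q1 N. D \<inter> b = {})"
    by (rule exE)
  have "late_values le K1 q1 (max N n) \<noteq> {}"
    using fr1 le_refl le_in q1(1) unfolding frequent_def by blast
  then obtain D where D: "D \<in> late_values le K1 q1 (max N n)" by blast
  have "D \<in> late_values le K q n"
    using D late_values_mono[OF K1(1), of n "max N n" le q1] late_values_below[OF q1(1), of K n] by auto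
  moreover obtain s k where "(s, k, D) \<in> K"
    using calculation unfolding late_values_def by blast
  then have "D \<noteq> {}"
    using K unfolding approximates_def by fast
  ultimately obtain a where a: "a \<in> F" "D \<inter> a \<noteq> {}" using cov by blast
  have hit: "D \<inter> a \<noteq> {}" if "D \<in> late_values le K1 q1 N" for D
    using bspec[OF N a(1)] that D a(2) late_values_mono[of K1 K1 N "max N n" le q1] by auto
  have "frequent le (hitting {a} K1) q1"
    unfolding frequent_def
  proof (intro allI impI)
    fix q' m assume q': "(q', q1) \<in> le"
    then have "late_values le K1 q' (max m N) \<noteq> {}" using fr1 unfolding frequent_def by blast
    then obtain r k D where r: "(r, k, D) \<in> K1" "(r, q') \<in> le" "m < k" "N < k"
      unfolding late_values_def by auto
    then have "D \<in> late_values le K1 q1 N" unfolding late_values_def using q' le_trans by blast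
    then have "(r, k, D) \<in> hitting {a} K1" using hit r(1) unfolding hitting_def by auto
    then show "late_values le (hitting {a} K1) q' m \<noteq> {}" using r unfolding late_values_def by blast
  qed
  then show ?thesis using q1(1) K1(1,4) fr1 ex a(1) F(2) by blast
qed

text \<open>
  The recursion defines, at index \<open>i\<close>, a new member \<open>a i\<close> and a subset \<open>L i\<close> of the
  approximation coded by \<open>i\<close> that settles all members present at that time, \<open>a i\<close> included.

  An approximation \<open>K\<close> with index \<open>j\<close> ends up in one of two ways.  If, at no later stage,
  the relevant terms of \<open>L j\<close> are covered by finitely many members, then all \<open>a l\<close> with \<open>l\<close>
  after \<open>j\<close> were made to meet the terms of \<open>L j\<close> in such a way that their traces are
  centered, and all other members are settled.  If a covering does occur, then
  below some condition the covered terms alone form an infinite subsequence on which every trace is finite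
  or cofinite.
\<close>

theorem absorbing_exists:
  assumes ch: "continuum_hypothesis" and B: "almost_disjoint_family B" "countable B"
  obtains A where "B \<subseteq> A" "almost_disjoint_family A" "absorbing Q le A"
proof -
  obtain R :: "nat set rel" where R: "wf R" "trans R" "total R" "\<And>i. countable {j. (j, i) \<in> R}"
    "\<And>j. \<exists>i. (j, i) \<in> R"
    using ex_well_order_with_countable_segments[OF ch] by blast
  \<comment> \<open>\<open>f i\<close> consists of the new member \<open>a i\<close> and of \<open>L i\<close>.\<close>
  define before where "before = (\<lambda>(f :: nat set \<Rightarrow> nat set \<times> 'q approximation) i. B \<union> (fst \<circ> f) ` {j. (j, i) \<in> R})"
  define seqs where "seqs = (\<lambda>(f :: nat set \<Rightarrow> nat set \<times> 'q approximation) i. (snd \<circ> f) ` {j. (j, i) \<in> R})"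
  have "\<exists>f. \<forall>i. next_stage (before f i) (seqs f i) (decode Q le i) (fst (f i)) (snd (f i))"
  proof (rule dependent_wf_choice[OF R(1)])
    fix f g :: "nat set \<Rightarrow> nat set \<times> 'q approximation" and i r
    assume eq: "\<And>j. (j, i) \<in> R \<Longrightarrow> f j = g j"
    have "before f i = before g i" "seqs f i = seqs g i"
      unfolding before_def seqs_def using eq by (auto simp: image_iff)
    then show "next_stage (before f i) (seqs f i) (decode Q le i) (fst r) (snd r) =
               next_stage (before g i) (seqs g i) (decode Q le i) (fst r) (snd r)" by simp
  next
    fix i and f :: "nat set \<Rightarrow> nat set \<times> 'q approximation"
    assume IH: "\<And>j. (j, i) \<in> R \<Longrightarrow> next_stage (before f j) (seqs f j) (decode Q le j) (fst (f j)) (snd (f j))"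
    have "\<not> - E \<subseteq> \<Union>F" if F: "F \<subseteq> before f i" "finite F" "finite E" for F E
    proof (rule almost_disjoint_not_covered[of B])
      show "finite (b \<inter> c)" if b: "b \<in> B" "c \<in> F" "b \<noteq> c" for b c
      proof (cases "c \<in> B")
        case True then show ?thesis using B b unfolding almost_disjoint_family_def by blast
      next
        case False
        then obtain j where "(j, i) \<in> R" "c = fst (f j)"
          using F(1) b(2) unfolding before_def by auto
        then show ?thesis
          using IH[of j] b(1) unfolding next_stage_def before_def by (simp add: Int_commute)
      qed
    qed (use B F in \<open>auto simp: almost_disjoint_family_def\<close>)
    moreover have "countable (before f i)" "countable (seqs f i)" "before f i \<noteq> {}"
      unfolding before_def seqs_def using B R(4) by (auto simp: almost_disjoint_family_def)
    ultimately have "\<exists>a K'. next_stage (before f i) (seqs f i) (decode Q le i) a K'"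
      by (intro next_stage_exists downward_decode) auto
    then show "\<exists>r. next_stage (before f i) (seqs f i) (decode Q le i) (fst r) (snd r)"
      by auto
  qed
  then obtain f where f: "\<And>i. next_stage (before f i) (seqs f i) (decode Q le i) (fst (f i)) (snd (f i))"
    by blast
  define a where "a = (\<lambda>i. fst (f i))"
  define L where "L = (\<lambda>i. snd (f i))"
  have before: "before f i = B \<union> a ` {j. (j, i) \<in> R}" for i
    unfolding before_def a_def by auto
  have a: "infinite (a i)" "\<And>b. b \<in> before f i \<Longrightarrow> finite (a i \<inter> b)" for i
    using f[of i] unfolding next_stage_def a_def by auto
  have down: "downward le (L i)" for i
    using f[of i] unfolding next_stage_def L_def by auto
  have L: "L i \<subseteq> decode Q le i" "\<And>q. q \<in> Q \<Longrightarrow> frequent le (decode Q le i) q \<Longrightarrow> frequent le (L i) q"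
      "\<And>b q. b \<in> insert (a i) (before f i) \<Longrightarrow> q \<in> Q \<Longrightarrow> \<exists>r. (r, q) \<in> le \<and> settles le (L i) b r" for i
    using f[of i] unfolding next_stage_def a_def L_def by auto
  have hit: "(\<exists>F'\<subseteq>before f i. finite F' \<and> \<Union>(late_values le (hitting F (L j)) q n) \<subseteq> \<Union>F') \<or>
        late_values le (hitting (insert (a i) F) (L j)) q n \<noteq> {}"
    if "(j, i) \<in> R" "F \<subseteq> before f i" "finite F" "q \<in> Q" for i j F q n
  proof -
    have "L j \<in> seqs f i" unfolding seqs_def L_def using that(1) by auto
    then show ?thesis using f[of i] that unfolding next_stage_def a_def by blast
  qed
  define A where "A = B \<union> range a"
  have aa: "finite (a i \<inter> a j)" if "i \<noteq> j" for i j
  proof -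
    have "(i, j) \<in> R \<or> (j, i) \<in> R" using R(3) that unfolding total_on_def by auto
    then show ?thesis using a(2)[of "a i" j] a(2)[of "a j" i] unfolding before by (auto simp: Int_commute)
  qed
  have ab: "finite (a i \<inter> b)" if "b \<in> B" for i b
    using a(2) that unfolding before by auto
  have ad: "finite (x \<inter> y)" if xy: "x \<in> A" "y \<in> A" "x \<noteq> y" for x y
  proof -
    consider "x \<in> B" "y \<in> B" | i where "x = a i" "y \<in> B" | i where "y = a i" "x \<in> B"
      | i j where "x = a i" "y = a j"
      using xy(1,2) unfolding A_def by blast
    then show ?thesis
    proof cases
      case 1
      then show ?thesis using xy(3) B(1) unfolding almost_disjoint_family_def by simp
    next
      case 2
      then show ?thesis using ab by simp
    next
      case 3
      then show ?thesis using ab[of x i] by (simp add: Int_commute)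
    next
      case 4
      then show ?thesis using aa[of i j] xy(3) by blast
    qed
  qed
  show ?thesis
  proof (rule that)
    show "B \<subseteq> A" unfolding A_def by auto
    show "almost_disjoint_family A"
      using ad a(1) B(1) unfolding almost_disjoint_family_def A_def by auto
    show "absorbing Q le A"
      unfolding absorbing_def
    proof (intro ballI allI impI)
      fix q K assume q: "q \<in> Q" and K: "approximates Q le K" "frequent le K q"
      obtain j where j: "decode Q le j = K" using decode_surj[OF K(1)] by blast
      have frL: "frequent le (L j) q" using L(2) j K(2) q by blast
      have apL: "approximates Q le (hitting F (L j))" for F
      proof -
        have "hitting F (L j) \<subseteq> K" using hitting_subset L(1)[of j] j by blast
        then show ?thesis
          using K(1) downward_hitting[OF down] unfolding approximates_def by (meson subset_trans subsetD)
      qed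
      define later where "later = {l. (j, l) \<in> R}"
      show "\<exists>q' K' S. (q', q) \<in> le \<and> captures le A K q' K' S"
      proof (cases "\<forall>G\<subseteq>later. finite G \<longrightarrow> frequent le (hitting (a ` G) (L j)) q")
        case True
        have fr: "frequent le (hitting F (L j)) q" if F: "F \<subseteq> a ` later" "finite F" for F
          using finite_subset_image[OF F(2,1)] True by blast
        obtain l where l: "(j, l) \<in> R" using R(5) by blast
        show ?thesis
          unfolding captures_def
        proof (intro exI conjI)
          show "(q, q) \<in> le" using q le_refl by blast
          show "L j \<subseteq> K" using L(1) j by blast
          show "downward le (L j)" by (rule down)
          show "a ` later \<subseteq> A" unfolding A_def by auto
          show "\<forall>F\<subseteq>a ` later. finite F \<longrightarrow> frequent le (hitting F (L j)) q" using fr by blast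
          show "\<exists>a\<in>A. frequent le (hitting {a} (L j)) q"
            using fr[of "{a l}"] l unfolding later_def A_def by auto
          show "\<forall>b\<in>A - a ` later. \<forall>r. (r, q) \<in> le \<longrightarrow> (\<exists>r'. (r', r) \<in> le \<and> settles le (L j) b r')"
          proof (intro ballI allI impI)
            fix b r assume b: "b \<in> A - a ` later" and r: "(r, q) \<in> le"
            have "(i, j) \<in> R" if "b = a i" "i \<noteq> j" for i
              using R(3) that b unfolding later_def total_on_def by (metis DiffE UNIV_I image_eqI mem_Collect_eq)
            then have "b \<in> insert (a j) (before f j)"
              using b unfolding A_def before by blast
            then show "\<exists>r'. (r', r) \<in> le \<and> settles le (L j) b r'"
              using L(3) r le_in by blast
          qed
        qed
      next
        case False
        \<comment> \<open>Otherwise a covering has occurred: if it had not, induction on the number of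
          later members would show that any finitely many of them meet arbitrarily late terms
          simultaneously.\<close>
        have "\<exists>G q1 n F. G \<subseteq> later \<and> finite G \<and> (q1, q) \<in> le \<and> frequent le (hitting (a ` G) (L j)) q1 \<and>
          F \<subseteq> A \<and> finite F \<and> \<Union>(late_values le (hitting (a ` G) (L j)) q1 n) \<subseteq> \<Union>F"
        proof (rule ccontr)
          assume none: "\<not> ?thesis"
          have "frequent le (hitting (a ` G) (L j)) q" if "card G = n" "finite G" "G \<subseteq> later" for G n
            using that
          proof (induction n arbitrary: G)
            case 0 then show ?case using frL by simp
          next
            case (Suc n)
            \<comment> \<open>The member of \<open>a ` G\<close> added last was chosen when all the others were present.\<close>
            then obtain l where l: "l \<in> G" "\<And>x. x \<in> G \<Longrightarrow> x \<noteq> l \<Longrightarrow> (x, l) \<in> R"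
              using ex_max_of_total[OF R(3,2)] by (metis card.empty nat.distinct(1))
            define G' where "G' = G - {l}"
            have G': "card G' = n" "finite G'" "G' \<subseteq> later" "G = insert l G'"
              using Suc.prems l(1) unfolding G'_def by auto
            have fr': "frequent le (hitting (a ` G') (L j)) q" by (rule Suc.IH[OF G'(1-3)])
            show ?case
              unfolding frequent_def
            proof (intro allI impI)
              fix q1 m assume q1: "(q1, q) \<in> le"
              have "(j, l) \<in> R" using l(1) Suc.prems(3) unfolding later_def by blast
              moreover have "a ` G' \<subseteq> before f l" using l(2) unfolding before G'_def by blast
              ultimately have "(\<exists>F'\<subseteq>before f l. finite F' \<and> \<Union>(late_values le (hitting (a ` G') (L j)) q1 m) \<subseteq> \<Union>F') \<or>
                  late_values le (hitting (insert (a l) (a ` G')) (L j)) q1 m \<noteq> {}"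
                by (rule hit[OF _ _ _ le_in(1)[OF q1]]) (simp add: G'(2))
              moreover have "before f l \<subseteq> A" unfolding before A_def by auto
              moreover have "frequent le (hitting (a ` G') (L j)) q1" using fr' q1 frequent_below by blast
              ultimately show "late_values le (hitting (a ` G) (L j)) q1 m \<noteq> {}"
                using none q1 G'(2,3) unfolding G'(4) image_insert by (meson order_trans)
            qed
          qed
          then show False using False by blast
        qed
        then obtain G q1 n F where q1: "(q1, q) \<in> le" and G: "frequent le (hitting (a ` G) (L j)) q1"
          and F: "F \<subseteq> A" "finite F" "\<Union>(late_values le (hitting (a ` G) (L j)) q1 n) \<subseteq> \<Union>F" by blast
        have "q1 \<in> Q" using q1 le_in by blast
        obtain q2 K2 where 2: "(q2, q1) \<in> le" "K2 \<subseteq> hitting (a ` G) (L j)" "frequent le K2 q2"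
          "\<forall>b\<in>A. \<forall>r. (r, q2) \<in> le \<longrightarrow> (\<exists>r'. (r', r) \<in> le \<and> settles le K2 b r')"
          "\<exists>a\<in>A. frequent le (hitting {a} K2) q2" "downward le K2"
          using ex_settling_subset_if_covered[OF apL \<open>q1 \<in> Q\<close> G F(2,1,3) ad] by blast
        have "K2 \<subseteq> K"
          using 2(2) hitting_subset L(1) j by blast
        show ?thesis
          unfolding captures_def
        proof (intro exI conjI)
          show "(q2, q) \<in> le" by (rule le_trans[OF 2(1) q1])
          show "K2 \<subseteq> K" by fact
          show "downward le K2" by (rule 2(6))
          show "\<forall>F\<subseteq>{}. finite F \<longrightarrow> frequent le (hitting F K2) q2" using 2(3) by simp
          show "\<forall>b\<in>A - {}. \<forall>r. (r, q2) \<in> le \<longrightarrow> (\<exists>r'. (r', r) \<in> le \<and> settles le K2 b r')"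
            using 2(4) unfolding Diff_empty .
          show "\<exists>a\<in>A. frequent le (hitting {a} K2) q2" by (rule 2(5))
        qed simp_all
      qed
    qed
  qed
qed

end

section \<open>Several posets at once, and the ground model\<close>

definition transport :: "('a \<Rightarrow> 'b) \<Rightarrow> 'a approximation \<Rightarrow> 'b approximation" where
  "transport f K = (\<lambda>(r, k, D). (f r, k, D)) ` K"

text \<open>
  A poset that sits as a downward closed part inside a larger one inherits the absorbing
  property.  This allows one construction to handle several posets at once.
\<close>

lemma absorbing_transfer:
  assumes A: "absorbing Q le A" and inj: "inj f" and f: "\<And>p. p \<in> P \<Longrightarrow> f p \<in> Q"
    and le': "le' \<subseteq> P \<times> P" and iff: "\<And>p q. p \<in> P \<Longrightarrow> q \<in> P \<Longrightarrow> (f p, f q) \<in> le \<longleftrightarrow> (p, q) \<in> le'"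
    and down: "\<And>s q. q \<in> P \<Longrightarrow> (s, f q) \<in> le \<Longrightarrow> s \<in> f ` P"
  shows "absorbing P le' A"
proof -
  let ?t = "transport f"
  have t_iff: "(f r, k, D) \<in> ?t K \<longleftrightarrow> (r, k, D) \<in> K" for r k D K
    using inj unfolding transport_def by (force dest: injD)
  have t_ex: "\<exists>r. x = f r" if "(x, k, D) \<in> ?t K" for x k D K
    using that unfolding transport_def by auto
  have ext: "K = K'" if "\<And>r k D. (f r, k, D) \<in> K \<longleftrightarrow> (f r, k, D) \<in> K'"
      "\<And>x k D. (x, k, D) \<in> K \<Longrightarrow> x \<in> range f" "\<And>x k D. (x, k, D) \<in> K' \<Longrightarrow> x \<in> range f" for K K'
  proof -
    have "(x, k, D) \<in> K \<longleftrightarrow> (x, k, D) \<in> K'" for x k D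
    proof (cases "x \<in> range f")
      case True then show ?thesis using that(1) by blast
    next
      case False then show ?thesis using that(2,3) by blast
    qed
    then show ?thesis by auto
  qed
  have hit: "hitting F (?t K) = ?t (hitting F K)" for F K
    by (rule ext) (auto simp: t_iff hitting_def dest: t_ex)
  have vals: "late_values le (?t K) (f q) n = late_values le' K q n" if "K \<subseteq> P \<times> UNIV" "q \<in> P" for K q n
  proof -
    have "(f r, f q) \<in> le \<longleftrightarrow> (r, q) \<in> le'" if "(r, k, D) \<in> K" for r k D
      using that iff \<open>K \<subseteq> P \<times> UNIV\<close> \<open>q \<in> P\<close> by blast
    then show ?thesis
      unfolding late_values_def using t_iff t_ex by (metis (no_types, lifting))
  qed
  have fr: "frequent le (?t K) (f q) \<longleftrightarrow> frequent le' K q" if KP: "K \<subseteq> P \<times> UNIV" and qP: "q \<in> P" for K q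
  proof
    assume *: "frequent le (?t K) (f q)"
    show "frequent le' K q"
      unfolding frequent_def
    proof (intro allI impI)
      fix q' n assume "(q', q) \<in> le'"
      then have "q' \<in> P" "(f q', f q) \<in> le" using le' iff qP by auto
      then show "late_values le' K q' n \<noteq> {}" using * vals[OF KP] unfolding frequent_def by metis
    qed
  next
    assume *: "frequent le' K q"
    show "frequent le (?t K) (f q)"
      unfolding frequent_def
    proof (intro allI impI)
      fix s n assume s: "(s, f q) \<in> le"
      then obtain q' where q': "s = f q'" "q' \<in> P" using down[OF qP] by blast
      then have "(q', q) \<in> le'" using s iff qP by blast
      then show "late_values le (?t K) s n \<noteq> {}" using * vals[OF KP] q' unfolding frequent_def by metis
    qed
  qed
  have dw: "downward le (?t K)" if KP: "K \<subseteq> P \<times> UNIV" and dK: "downward le' K" for K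
    unfolding downward_def
  proof (intro allI impI)
    fix s k D r assume s: "(s, k, D) \<in> ?t K" and r: "(r, s) \<in> le"
    then obtain p where p: "s = f p" "(p, k, D) \<in> K" using t_ex t_iff by metis
    then have "p \<in> P" using KP by blast
    then obtain r' where r': "r = f r'" "r' \<in> P" using down r p(1) by blast
    then have "(r', p) \<in> le'" using r p(1) iff \<open>p \<in> P\<close> by blast
    then have "(r', k, D) \<in> K" using p(2) dK unfolding downward_def by blast
    then show "(r, k, D) \<in> ?t K" using r'(1) t_iff by blast
  qed
  show ?thesis
    unfolding absorbing_def
  proof (intro ballI allI impI)
    fix q K assume q: "q \<in> P" and K: "approximates P le' K" "frequent le' K q"
    have KP: "K \<subseteq> P \<times> UNIV" and dK: "downward le' K"
      using K(1) unfolding approximates_def by auto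
    have "approximates Q le (?t K)"
      unfolding approximates_def
    proof (intro conjI allI impI)
      show "?t K \<subseteq> Q \<times> UNIV \<times> {D. finite D \<and> D \<noteq> {}}"
        using K(1) f unfolding approximates_def transport_def by fast
      show "downward le (?t K)" by (rule dw[OF KP dK])
    next
      fix s k D s' k' D'
      assume 1: "(s, k, D) \<in> ?t K" "(s', k', D') \<in> ?t K" "(s', s) \<in> le" "D \<inter> D' \<noteq> {}"
      then obtain p p' where p: "s = f p" "s' = f p'" using t_ex by metis
      then have pK: "(p, k, D) \<in> K" "(p', k', D') \<in> K" using 1 t_iff by auto
      then have "p \<in> P" "p' \<in> P" using KP by auto
      then have "(p', p) \<in> le'" using 1(3) p iff by simp
      then show "k = k'" using K(1) pK 1(4) unfolding approximates_def by blast
    qed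
    moreover have "frequent le (?t K) (f q)" using fr[OF KP q] K(2) by simp
    ultimately have "\<exists>x L S. (x, f q) \<in> le \<and> captures le A (?t K) x L S"
      by (rule absorbingD[OF A f[OF q]])
    then obtain x L S where L: "(x, f q) \<in> le" and cap: "captures le A (?t K) x L S"
      by (elim exE conjE)
    note L = L capturesD[OF cap]
    obtain q1 where q1: "x = f q1" "q1 \<in> P" using down[OF q L(1)] by blast
    define K1 where "K1 = {(r, k, D). (f r, k, D) \<in> L}"
    have LK1: "L = ?t K1"
    proof (rule ext)
      show "x \<in> range f" if "(x, k, D) \<in> L" for x k D
        using that L(2) t_ex by blast
      show "x \<in> range f" if "(x, k, D) \<in> ?t K1" for x k D
        using that t_ex by blast
    qed (auto simp: t_iff K1_def)
    have K1: "K1 \<subseteq> K" unfolding K1_def using L(2) t_iff by blast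
    have K1P: "K1 \<subseteq> P \<times> UNIV" "\<And>F. hitting F K1 \<subseteq> P \<times> UNIV"
      using K1 KP hitting_subset by blast+
    show "\<exists>q' K' S. (q', q) \<in> le' \<and> captures le' A K q' K' S"
      unfolding captures_def
    proof (intro exI conjI)
      show "(q1, q) \<in> le'" using L(1) q1 q iff by simp
      show "K1 \<subseteq> K" by fact
      show "S \<subseteq> A" by fact
      show "\<forall>F\<subseteq>S. finite F \<longrightarrow> frequent le' (hitting F K1) q1"
        using L(5) unfolding LK1 hit q1(1) fr[OF K1P(2) q1(2)] by simp
      show "\<exists>a\<in>A. frequent le' (hitting {a} K1) q1"
        using L(7) unfolding LK1 hit q1(1) fr[OF K1P(2) q1(2)] .
      show "downward le' K1"
        unfolding downward_def
      proof (intro allI impI)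
        fix s k D r assume s: "(s, k, D) \<in> K1" and r: "(r, s) \<in> le'"
        then have "(f r, f s) \<in> le" using le' iff by blast
        then show "(r, k, D) \<in> K1" using s L(3) unfolding K1_def downward_def by blast
      qed
      show "\<forall>b\<in>A - S. \<forall>r. (r, q1) \<in> le' \<longrightarrow> (\<exists>r'. (r', r) \<in> le' \<and> settles le' K1 b r')"
      proof (intro ballI allI impI)
        fix b r assume b: "b \<in> A - S" and r: "(r, q1) \<in> le'"
        then have "r \<in> P" "(f r, x) \<in> le" using le' iff q1 by auto
        then obtain s where s: "(s, f r) \<in> le" "settles le L b s" using L(6)[of b "f r"] b by blast
        then obtain r' where r': "s = f r'" "r' \<in> P" using down \<open>r \<in> P\<close> by blast
        then have "(r', r) \<in> le'" using s(1) iff \<open>r \<in> P\<close> by simp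
        moreover have "settles le' K1 b r'"
          using s(2) unfolding settles_def LK1 r'(1) vals[OF K1P(1) r'(2)] .
        ultimately show "\<exists>r'. (r', r) \<in> le' \<and> settles le' K1 b r'" by blast
      qed
    qed
  qed
qed

abbreviation trivial_order :: "unit rel" where
  "trivial_order \<equiv> {((), ())}"

lemma frequent_trivial:
  "frequent trivial_order K () \<longleftrightarrow> (\<forall>n. \<exists>k D. ((), k, D) \<in> K \<and> n < k)"
  unfolding frequent_def late_values_def by (auto, blast+)

text \<open>
  A set that is almost disjoint from all of \<open>A\<close> would, viewed as a sequence of singletons, be
  hit infinitely often by a member of \<open>A\<close>.
\<close>

lemma absorbing_trivial_imp_mad:
  assumes A: "almost_disjoint_family A" and abs: "absorbing {()} trivial_order A"
  shows "mad A"
  unfolding mad_def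
proof (intro conjI notI)
  show "almost_disjoint_family A" by fact
  assume "\<exists>B. almost_disjoint_family B \<and> A \<subset> B"
  then obtain B x where B: "almost_disjoint_family B" "A \<subseteq> B" "x \<in> B" "x \<notin> A" by blast
  define K where "K = (\<lambda>n. ((), n, {n})) ` x"
  have "infinite x" using B unfolding almost_disjoint_family_def by blast
  then have "frequent trivial_order K ()"
    unfolding frequent_trivial K_def infinite_nat_iff_unbounded by blast
  moreover have "approximates {()} trivial_order K"
    unfolding approximates_def downward_def K_def by auto
  ultimately have "\<exists>q K1 S. (q, ()) \<in> trivial_order \<and> captures trivial_order A K q K1 S"
    by (intro absorbingD[OF abs]) simp_all
  then obtain K1 S where cap: "captures trivial_order A K () K1 S" by auto
  obtain a where a: "K1 \<subseteq> K" "a \<in> A" "frequent trivial_order (hitting {a} K1) ()"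
    using capturesD(1,6)[OF cap] by blast
  have "infinite (a \<inter> x)"
    unfolding infinite_nat_iff_unbounded
  proof
    fix n
    obtain k D where "((), k, D) \<in> hitting {a} K1" "n < k"
      using a(3) unfolding frequent_trivial by blast
    then show "\<exists>m>n. m \<in> a \<inter> x" using a(1) unfolding hitting_def K_def by auto
  qed
  moreover have "a \<noteq> x" "a \<in> B" using a B by auto
  ultimately show False using B unfolding almost_disjoint_family_def by blast
qed

text \<open>
  With a single condition nothing has to be decided: the index set \<open>I\<close> is
  a set of the ground model, and each member of \<open>A - S\<close> has a finite or cofinite trace on it.
\<close>

lemma absorbing_trivial_imp_fin_intersecting:
  assumes A: "almost_disjoint_family A" and abs: "absorbing {()} trivial_order A"
  shows "fin_intersecting A"
  unfolding fin_intersecting_def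
proof (intro conjI allI impI)
  show "almost_disjoint_family A" by fact
  fix C assume C: "fin_sequence C"
  define K where "K = range (\<lambda>k. ((), k, C k))"
  have "frequent trivial_order K ()"
    unfolding frequent_trivial K_def by (auto intro: lessI)
  moreover have "approximates {()} trivial_order K"
    using C unfolding approximates_def downward_def K_def fin_sequence_def by fastforce
  ultimately have "\<exists>q K1 S. (q, ()) \<in> trivial_order \<and> captures trivial_order A K q K1 S"
    by (intro absorbingD[OF abs]) simp_all
  then obtain K1 S where cap: "captures trivial_order A K () K1 S" by auto
  note K1 = capturesD(1,3)[OF cap] and S = capturesD(4)[OF cap]
  have nS: "settles trivial_order K1 b ()" if "b \<in> A - S" for b
    using capturesD(5)[OF cap, of b "()"] that by auto
  define I where "I = {k. ((), k, C k) \<in> K1}"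
  have K1_iff: "((), k, D) \<in> K1 \<longleftrightarrow> k \<in> I \<and> D = C k" for k D
    using K1(1) unfolding I_def K_def by auto
  have "infinite I"
    using S[of "{}"] unfolding frequent_trivial infinite_nat_iff_unbounded by (auto simp: K1_iff)
  define tr where "tr a = {n \<in> I. a \<inter> C n \<noteq> {}}" for a
  have "centered ({{n \<in> I. a \<inter> C n \<noteq> {}} | a. a \<in> A} - {x. x \<subseteq> I \<and> finite x})"
    unfolding centered_def
  proof (intro allI impI, elim conjE)
    fix F assume F: "F \<subseteq> {{n \<in> I. a \<inter> C n \<noteq> {}} | a. a \<in> A} - {x. x \<subseteq> I \<and> finite x}" "finite F" "F \<noteq> {}"
    have tr: "F \<subseteq> tr ` {a \<in> A. infinite (tr a)}"
      using F(1) unfolding tr_def by blast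
    obtain T where T: "T \<subseteq> {a \<in> A. infinite (tr a)}" "finite T" "F = tr ` T"
      using finite_subset_image[OF F(2) tr] by (elim exE conjE)
    have "\<exists>N. \<forall>b\<in>T - S. (\<forall>D\<in>late_values trivial_order K1 () N. D \<inter> b \<noteq> {}) \<or> (\<forall>D\<in>late_values trivial_order K1 () N. D \<inter> b = {})"
      by (rule settles_uniformly) (use T nS in auto)
    then obtain N where N: "\<forall>b\<in>T - S. (\<forall>D\<in>late_values trivial_order K1 () N. D \<inter> b \<noteq> {}) \<or> (\<forall>D\<in>late_values trivial_order K1 () N. D \<inter> b = {})"
      by (rule exE)
    have vals: "C k \<in> late_values trivial_order K1 () N" if "k \<in> I" "N < k" for k
      using that unfolding late_values_def by (auto simp: K1_iff intro!: exI[of _ k])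
    have hits: "b \<inter> C k \<noteq> {}" if b: "b \<in> T - S" and k: "k \<in> I" "N < k" for b k
    proof -
      have "infinite (tr b)" using b T(1) by blast
      then obtain m where m: "m \<in> tr b" "N < m" unfolding infinite_nat_iff_unbounded by blast
      then have "C m \<inter> b \<noteq> {}" "C m \<in> late_values trivial_order K1 () N"
        using vals unfolding tr_def by auto
      then have "\<forall>D\<in>late_values trivial_order K1 () N. D \<inter> b \<noteq> {}"
        using bspec[OF N b] by blast
      then show ?thesis using vals[OF k] by blast
    qed
    show "infinite (\<Inter>F)"
      unfolding infinite_nat_iff_unbounded
    proof
      fix n
      have "frequent trivial_order (hitting (T \<inter> S) K1) ()" using S T(2) by auto
      then obtain k D where k: "((), k, D) \<in> hitting (T \<inter> S) K1" "max n N < k"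
        unfolding frequent_trivial by meson
      have "((), k, D) \<in> K1" using k(1) unfolding hitting_def by simp
      then have kI: "k \<in> I" "D = C k" by (simp_all add: K1_iff)
      have kT: "\<forall>b\<in>T \<inter> S. C k \<inter> b \<noteq> {}" using k(1) unfolding hitting_def kI(2) by simp
      have "b \<inter> C k \<noteq> {}" if "b \<in> T" for b
      proof (cases "b \<in> S")
        case True
        then show ?thesis using kT that by blast
      next
        case False
        then show ?thesis using hits that kI(1) k(2) by simp
      qed
      then have "k \<in> \<Inter>F" using kI(1) T(3) unfolding tr_def by auto
      then show "\<exists>m>n. m \<in> \<Inter>F" using k(2) by auto
    qed
  qed
  then show "\<exists>I. infinite I \<and>
           centered ({{n\<in>I. a \<inter> C n \<noteq> {}} | a. a \<in> A} - {x. x \<subseteq> I \<and> finite x})"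
    using \<open>infinite I\<close> by blast
qed

text \<open>
  The additional condition \<open>None\<close> is comparable only to itself, so that statements forced by it
  are statements about the ground model.
\<close>

definition option_order :: "'p rel \<Rightarrow> 'p option rel" where
  "option_order le = insert (None, None) ((\<lambda>(a, b). (Some a, Some b)) ` le)"

text \<open>
  An index set in the extension need not contain an infinite set of the ground model,
  hence the fin-intersecting property of the extension does not yield the one of the
  ground model.  Adding an isolated condition to \<open>P\<close> makes the same family work for both.
\<close>

lemma absorbing_family_exists:
  fixes P :: "'p set"
  assumes "continuum_hypothesis" "countable P" "preorder_on P le"
    and B: "almost_disjoint_family B" "countable B"
  obtains A where "B \<subseteq> A" "almost_disjoint_family A" "absorbing P le A"
    "absorbing {()} trivial_order A"
proof -
  define Q where "Q = insert None (Some ` P)"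
  have le: "le \<subseteq> P \<times> P" using assms(3) unfolding preorder_on_def by blast
  have "countable_preorder Q (option_order le)"
  proof
    show "countable Q" unfolding Q_def using assms(2) by simp
    show "preorder_on Q (option_order le)"
      unfolding preorder_on_def
    proof (intro conjI)
      show "option_order le \<subseteq> Q \<times> Q" unfolding option_order_def Q_def using le by auto
      show "refl_on Q (option_order le)"
        using assms(3) unfolding option_order_def Q_def preorder_on_def refl_on_def by auto
      show "trans (option_order le)"
        using assms(3) unfolding option_order_def preorder_on_def trans_def by fastforce
    qed
  qed
  then obtain A where A: "B \<subseteq> A" "almost_disjoint_family A" "absorbing Q (option_order le) A"
    using countable_preorder.absorbing_exists assms(1) B by metis
  have "absorbing P le A"
    by (rule absorbing_transfer[OF A(3), of Some]) (use le in \<open>auto simp: Q_def option_order_def\<close>)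
  moreover have "absorbing {()} trivial_order A"
    by (rule absorbing_transfer[OF A(3), of "\<lambda>_. None"]) (auto simp: Q_def option_order_def inj_def)
  ultimately show ?thesis using that A by blast
qed

section \<open>Statements of the forcing language as regular open sets\<close>

sublocale forcing_poset \<subseteq> conditions P le
  by unfold_locales (rule preorder)

context forcing_poset
begin

text \<open>
  The statements of the forcing language correspond to regular open sets of conditions:
  they are inherited by stronger conditions, and hold at \<open>p\<close> when they hold densely below
  \<open>p\<close>.  For such statements the clauses for \<open>\<^bold>\<longrightarrow>\<close> and \<open>\<^bold>\<longleftrightarrow>\<close> reduce to the implication and
  the equivalence at all stronger conditions, and the one for existential quantifiers to
  the existence of a witness on a dense set.
\<close>

definition hereditary :: "'p statement \<Rightarrow> bool" where
  "hereditary \<phi> \<longleftrightarrow> (\<forall>p q. \<phi> p \<longrightarrow> (q, p) \<in> le \<longrightarrow> \<phi> q)"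

definition densely :: "'p statement \<Rightarrow> 'p statement" where
  "densely \<phi> = (\<lambda>p. \<forall>q. (q, p) \<in> le \<longrightarrow> (\<exists>r. (r, q) \<in> le \<and> \<phi> r))"

definition regular :: "'p statement \<Rightarrow> bool" where
  "regular \<phi> \<longleftrightarrow> hereditary \<phi> \<and> (\<forall>p\<in>P. densely \<phi> p \<longrightarrow> \<phi> p)"

lemma hereditaryD: "hereditary \<phi> \<Longrightarrow> \<phi> p \<Longrightarrow> (q, p) \<in> le \<Longrightarrow> \<phi> q"
  unfolding hereditary_def by blast

lemma regularD: "regular \<phi> \<Longrightarrow> p \<in> P \<Longrightarrow> densely \<phi> p \<Longrightarrow> \<phi> p"
  unfolding regular_def by blast

lemma regular_hereditary: "regular \<phi> \<Longrightarrow> hereditary \<phi>"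
  unfolding regular_def by blast

lemma denselyI: "(\<And>q. (q, p) \<in> le \<Longrightarrow> \<exists>r. (r, q) \<in> le \<and> \<phi> r) \<Longrightarrow> densely \<phi> p"
  unfolding densely_def by blast

lemma denselyE:
  assumes "densely \<phi> p" "(q, p) \<in> le"
  obtains r where "(r, q) \<in> le" "\<phi> r"
proof -
  have "\<exists>r. (r, q) \<in> le \<and> \<phi> r" using assms unfolding densely_def by simp
  then show ?thesis using that by (elim exE conjE)
qed

lemma densely_at:
  assumes "densely \<phi> p" "p \<in> P"
  obtains r where "(r, p) \<in> le" "\<phi> r"
  using denselyE[OF assms(1) le_refl[OF assms(2)]] .

lemma hereditary_densely: "hereditary (densely \<phi>)"
  unfolding hereditary_def densely_def using le_trans by blast

lemma regular_densely: "regular (densely \<phi>)"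
  unfolding regular_def
proof (intro conjI ballI impI denselyI)
  fix p q assume d: "densely (densely \<phi>) p" and q: "(q, p) \<in> le"
  obtain r where r: "(r, q) \<in> le" "densely \<phi> r" by (rule denselyE[OF d q])
  obtain s where s: "(s, r) \<in> le" "\<phi> s" by (rule densely_at[OF r(2) le_in(1)[OF r(1)]])
  show "\<exists>r. (r, q) \<in> le \<and> \<phi> r" using le_trans[OF s(1) r(1)] s(2) by blast
qed (rule hereditary_densely)

lemma densely_all_finite:
  assumes "finite T" "p \<in> P" "\<And>t. t \<in> T \<Longrightarrow> hereditary (\<Phi> t)" "\<And>t. t \<in> T \<Longrightarrow> densely (\<Phi> t) p"
  shows "\<exists>r. (r, p) \<in> le \<and> (\<forall>t\<in>T. \<Phi> t r)"
  using assms(1,3,4)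
proof (induction T rule: finite_induct)
  case empty
  then show ?case using le_refl[OF assms(2)] by blast
next
  case (insert t T)
  then obtain r where r: "(r, p) \<in> le" "\<forall>t\<in>T. \<Phi> t r" by auto
  have "densely (\<Phi> t) p" using insert.prems by blast
  then obtain s where s: "(s, r) \<in> le" "\<Phi> t s" using r(1) by (rule denselyE)
  have "\<Phi> u s" if "u \<in> T" for u
    using hereditaryD[of "\<Phi> u", OF _ bspec[OF r(2) that] s(1)] insert.prems(1) that by simp
  then show ?case using le_trans[OF s(1) r(1)] s(2) by blast
qed

lemma fEx_eq: "fEx D \<phi> = densely (\<lambda>p. \<exists>x\<in>D. \<phi> x p)"
  unfolding fEx_def fNot_def fAll_def densely_def by (intro ext) blast

lemma num_mem_eq: "num_mem n x = densely (\<lambda>p. \<exists>s. (n, s) \<in> x \<and> (p, s) \<in> le)"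
  unfolding num_mem_def densely_def ..

lemma set_mem_eq: "set_mem x X = densely (\<lambda>p. \<exists>y s. (y, s) \<in> X \<and> (p, s) \<in> le \<and> set_eq x y p)"
  unfolding set_mem_def densely_def ..

lemma hereditary_fNot [simp]: "hereditary (\<^bold>\<not> \<phi>)"
  unfolding hereditary_def fNot_def using le_trans by blast

lemma regular_fNot:
  assumes "hereditary \<phi>"
  shows "regular (\<^bold>\<not> \<phi>)"
  unfolding regular_def
proof (intro conjI ballI impI)
  fix p assume p: "p \<in> P" and d: "densely (\<^bold>\<not> \<phi>) p"
  show "(\<^bold>\<not> \<phi>) p"
    unfolding fNot_def
  proof (intro allI impI notI)
    fix q assume q: "(q, p) \<in> le" "\<phi> q"
    obtain r where r: "(r, q) \<in> le" "(\<^bold>\<not> \<phi>) r" by (rule denselyE[OF d q(1)])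
    have "\<phi> r" by (rule hereditaryD[OF assms q(2) r(1)])
    then show False using r(2) le_refl[OF le_in(1)[OF r(1)]] unfolding fNot_def by blast
  qed
qed (rule hereditary_fNot)

lemma hereditary_fAnd: "hereditary \<phi> \<Longrightarrow> hereditary \<psi> \<Longrightarrow> hereditary (\<phi> \<^bold>\<and> \<psi>)"
  unfolding hereditary_def fAnd_def by blast

lemma regular_fAnd [simp]: "regular \<phi> \<Longrightarrow> regular \<psi> \<Longrightarrow> regular (\<phi> \<^bold>\<and> \<psi>)"
  unfolding regular_def fAnd_def hereditary_def densely_def by blast

lemma regular_fAll [simp]: "(\<And>x. x \<in> D \<Longrightarrow> regular (\<phi> x)) \<Longrightarrow> regular (fAll D \<phi>)"
  unfolding regular_def fAll_def hereditary_def densely_def by blast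

lemma hereditary_fImp [simp]: "hereditary (\<phi> \<^bold>\<longrightarrow> \<psi>)"
  unfolding fImp_def by simp

lemma regular_fImp [simp]: "hereditary \<phi> \<Longrightarrow> regular (\<phi> \<^bold>\<longrightarrow> \<psi>)"
  unfolding fImp_def by (intro regular_fNot hereditary_fAnd hereditary_fNot)

lemma regular_fIff [simp]: "regular \<phi> \<Longrightarrow> regular \<psi> \<Longrightarrow> regular (\<phi> \<^bold>\<longleftrightarrow> \<psi>)"
  unfolding fIff_def by (simp add: regular_hereditary)

lemma regular_fEx [simp]: "regular (fEx D \<phi>)"
  unfolding fEx_eq by (rule regular_densely)

lemma regular_num_mem [simp]: "regular (num_mem n x)"
  unfolding num_mem_eq by (rule regular_densely)

lemma regular_set_mem [simp]: "regular (set_mem x X)"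
  unfolding set_mem_eq by (rule regular_densely)

lemma regular_set_eq [simp]: "regular (set_eq x y)"
  unfolding set_eq_def by simp

lemma regular_ground [simp]: "regular (ground b)"
  unfolding regular_def hereditary_def ground_def densely_def using le_refl by blast

lemma regular_fin_num [simp]: "regular (fin_num \<phi>)"
  unfolding fin_num_def by simp

lemma regular_meets [simp]: "regular (meets x y)"
  unfolding meets_def by simp

lemma fAnd_iff: "(\<phi> \<^bold>\<and> \<psi>) p \<longleftrightarrow> \<phi> p \<and> \<psi> p"
  unfolding fAnd_def ..

lemma fAll_iff: "fAll D \<phi> p \<longleftrightarrow> (\<forall>x\<in>D. \<phi> x p)"
  unfolding fAll_def ..

lemma fAndI: "\<phi> p \<Longrightarrow> \<psi> p \<Longrightarrow> (\<phi> \<^bold>\<and> \<psi>) p"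
  unfolding fAnd_def ..

lemma fAllI: "(\<And>x. x \<in> D \<Longrightarrow> \<phi> x p) \<Longrightarrow> fAll D \<phi> p"
  unfolding fAll_def ..

lemma fImpI:
  assumes "\<And>q. (q, p) \<in> le \<Longrightarrow> \<phi> q \<Longrightarrow> \<psi> q"
  shows "(\<phi> \<^bold>\<longrightarrow> \<psi>) p"
  unfolding fImp_def fNot_def fAnd_def
proof (intro allI impI notI, elim conjE)
  fix q assume q: "(q, p) \<in> le" "\<phi> q" "\<forall>r. (r, q) \<in> le \<longrightarrow> \<not> \<psi> r"
  then show False using assms[OF q(1,2)] le_refl[OF le_in(1)[OF q(1)]] by simp
qed

lemma fImpD:
  assumes "(\<phi> \<^bold>\<longrightarrow> \<psi>) p" "(q, p) \<in> le" "\<phi> q" "regular \<phi>" "regular \<psi>"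
  shows "\<psi> q"
proof (rule regularD[OF assms(5) le_in(1)[OF assms(2)]], rule denselyI)
  fix r assume r: "(r, q) \<in> le"
  have "\<phi> r" by (rule hereditaryD[OF regular_hereditary[OF assms(4)] assms(3) r])
  moreover have "(r, p) \<in> le" by (rule le_trans[OF r assms(2)])
  ultimately show "\<exists>s. (s, r) \<in> le \<and> \<psi> s"
    using assms(1) unfolding fImp_def fNot_def fAnd_def by blast
qed

lemma fIff_iff:
  assumes "regular \<phi>" "regular \<psi>"
  shows "(\<phi> \<^bold>\<longleftrightarrow> \<psi>) p \<longleftrightarrow> (\<forall>q. (q, p) \<in> le \<longrightarrow> (\<phi> q \<longleftrightarrow> \<psi> q))"
proof
  assume *: "(\<phi> \<^bold>\<longleftrightarrow> \<psi>) p"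
  then have "(\<phi> \<^bold>\<longrightarrow> \<psi>) p" "(\<psi> \<^bold>\<longrightarrow> \<phi>) p" unfolding fIff_def fAnd_def by auto
  then show "\<forall>q. (q, p) \<in> le \<longrightarrow> (\<phi> q \<longleftrightarrow> \<psi> q)"
    using fImpD assms by blast
next
  assume "\<forall>q. (q, p) \<in> le \<longrightarrow> (\<phi> q \<longleftrightarrow> \<psi> q)"
  then show "(\<phi> \<^bold>\<longleftrightarrow> \<psi>) p"
    unfolding fIff_def fAnd_def using fImpI[of p \<phi> \<psi>] fImpI[of p \<psi> \<phi>] by blast
qed

lemma set_eq_iff: "set_eq x y p \<longleftrightarrow> (\<forall>q. (q, p) \<in> le \<longrightarrow> (\<forall>n. num_mem n x q \<longleftrightarrow> num_mem n y q))"
  unfolding set_eq_def by (auto simp: fAll_iff fIff_iff)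

lemma set_eq_refl: "set_eq x x p"
  unfolding set_eq_iff by blast

lemma set_eq_sym: "set_eq x y p \<Longrightarrow> set_eq y x p"
  unfolding set_eq_iff by blast

lemma set_eq_trans: "set_eq x y p \<Longrightarrow> set_eq y z p \<Longrightarrow> set_eq x z p"
  unfolding set_eq_iff by blast

lemma set_eq_below: "set_eq x y p \<Longrightarrow> (q, p) \<in> le \<Longrightarrow> set_eq x y q"
  unfolding set_eq_iff using le_trans by blast

lemma set_eq_at: "set_eq x y p \<Longrightarrow> p \<in> P \<Longrightarrow> num_mem n x p \<longleftrightarrow> num_mem n y p"
  unfolding set_eq_iff using le_refl by blast

lemma num_mem_up:
  assumes "p \<in> P"
  shows "num_mem n (up a) p \<longleftrightarrow> n \<in> a"
proof
  assume "num_mem n (up a) p"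
  then show "n \<in> a" unfolding num_mem_eq up_def using assms by (auto elim: densely_at)
next
  assume "n \<in> a"
  then show "num_mem n (up a) p"
    unfolding num_mem_eq up_def
  proof (intro denselyI)
    fix q assume "(q, p) \<in> le"
    then have "(q, q) \<in> le" "(q, one) \<in> le" using le_in(1) le_refl one_greatest by auto
    then show "\<exists>r. (r, q) \<in> le \<and> (\<exists>s. (n, s) \<in> a \<times> {one} \<and> (r, s) \<in> le)"
      using \<open>n \<in> a\<close> by auto
  qed
qed

lemma set_eq_up: "p \<in> P \<Longrightarrow> set_eq (up a) (up b) p \<Longrightarrow> a = b"
  using set_eq_at[of "up a" "up b" p] by (auto simp: num_mem_up)

lemma up_in_set_names: "up a \<in> set_names"
  unfolding up_def set_names_def using one_in by auto

lemma set_mem_up: "set_mem x (up Y) = densely (\<lambda>p. \<exists>y\<in>Y. set_eq x y p)"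
proof -
  have "(\<exists>y s. (y, s) \<in> up Y \<and> (p, s) \<in> le \<and> set_eq x y p) \<longleftrightarrow> (\<exists>y\<in>Y. set_eq x y p)" if "p \<in> P" for p
    using one_greatest[OF that] unfolding up_def by auto
  then show ?thesis
    unfolding set_mem_eq densely_def using le_in(1) by (intro ext) blast
qed

lemma set_mem_check: "set_mem x (check_family A) = densely (\<lambda>p. \<exists>a\<in>A. set_eq x (up a) p)"
  unfolding check_family_def set_mem_up by simp

lemma set_mem_up_self: "y \<in> Y \<Longrightarrow> set_mem y (up Y) p"
  unfolding set_mem_up using set_eq_refl le_refl le_in(1) by (intro denselyI) blast

lemma set_mem_checkI: "a \<in> A \<Longrightarrow> set_mem (up a) (check_family A) p"
  unfolding check_family_def by (rule set_mem_up_self) simp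

lemma fin_num_iff:
  assumes "\<And>n. regular (\<phi> n)"
  shows "fin_num \<phi> = densely (\<lambda>p. \<exists>E. finite E \<and> (\<forall>q. (q, p) \<in> le \<longrightarrow> (\<forall>n. \<phi> n q \<longleftrightarrow> n \<in> E)))"
proof -
  have "fAll UNIV (\<lambda>n. \<phi> n \<^bold>\<longleftrightarrow> ground (n \<in> E)) p \<longleftrightarrow> (\<forall>q. (q, p) \<in> le \<longrightarrow> (\<forall>n. \<phi> n q \<longleftrightarrow> n \<in> E))" for E p
    unfolding fAll_iff fIff_iff[OF assms regular_ground] by (auto simp: ground_def)
  then show ?thesis unfolding fin_num_def fEx_eq by simp
qed

lemma fin_numE:
  assumes "fin_num \<phi> p" "\<And>n. regular (\<phi> n)" "p \<in> P"
  obtains r E where "(r, p) \<in> le" "finite E" "\<And>q n. (q, r) \<in> le \<Longrightarrow> \<phi> n q \<longleftrightarrow> n \<in> E"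
proof -
  have "densely (\<lambda>p. \<exists>E. finite E \<and> (\<forall>q. (q, p) \<in> le \<longrightarrow> (\<forall>n. \<phi> n q \<longleftrightarrow> n \<in> E))) p"
    using assms(1) unfolding fin_num_iff[OF assms(2)] .
  then obtain r where r: "(r, p) \<in> le" "\<exists>E. finite E \<and> (\<forall>q. (q, r) \<in> le \<longrightarrow> (\<forall>n. \<phi> n q \<longleftrightarrow> n \<in> E))"
    using assms(3) by (rule densely_at)
  from r(2) obtain E where "finite E" "\<forall>q. (q, r) \<in> le \<longrightarrow> (\<forall>n. \<phi> n q \<longleftrightarrow> n \<in> E)"
    by (elim exE conjE)
  then show ?thesis using that[OF r(1)] by simp
qed

lemma decide_finitely_many:
  assumes "finite T" "p \<in> P" "\<And>t. hereditary (\<Phi> t)"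
  shows "\<exists>r. (r, p) \<in> le \<and> (\<forall>t\<in>T. \<Phi> t r \<or> (\<^bold>\<not> \<Phi> t) r)"
proof (rule densely_all_finite[OF assms(1,2)])
  fix t
  show "hereditary (\<lambda>p. \<Phi> t p \<or> (\<^bold>\<not> \<Phi> t) p)"
    using assms(3)[of t] hereditary_fNot[of "\<Phi> t"] unfolding hereditary_def by blast
  show "densely (\<lambda>p. \<Phi> t p \<or> (\<^bold>\<not> \<Phi> t) p) p"
  proof (rule denselyI)
    fix q assume q: "(q, p) \<in> le"
    show "\<exists>r. (r, q) \<in> le \<and> (\<Phi> t r \<or> (\<^bold>\<not> \<Phi> t) r)"
      using le_refl[OF le_in(1)[OF q]] unfolding fNot_def by blast
  qed
qed

text \<open>
  The members up to the bound need not be known at \<open>p\<close>, but densely below \<open>p\<close> there is a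
  condition that decides all of them and thereby names the finite set.
\<close>

lemma fin_num_bounded:
  assumes reg: "\<And>n. regular (\<phi> n)" and b: "\<And>n q. (q, p) \<in> le \<Longrightarrow> N < n \<Longrightarrow> \<not> \<phi> n q"
  shows "fin_num \<phi> p"
  unfolding fin_num_iff[OF reg]
proof (rule denselyI)
  fix q assume q: "(q, p) \<in> le"
  obtain r where r: "(r, q) \<in> le" "\<forall>n\<in>{..N}. \<phi> n r \<or> (\<^bold>\<not> \<phi> n) r"
    using decide_finitely_many[of "{..N}" q \<phi>] le_in(1)[OF q] regular_hereditary[OF reg] by auto
  have "\<phi> n s \<longleftrightarrow> n \<in> {n. n \<le> N \<and> \<phi> n r}" if s: "(s, r) \<in> le" for s n
  proof (cases "n \<le> N")
    case True
    then consider "\<phi> n r" | "(\<^bold>\<not> \<phi> n) r" using r(2) by auto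
    then show ?thesis
    proof cases
      case 1
      then show ?thesis using True hereditaryD[OF regular_hereditary[OF reg] 1 s] by simp
    next
      case 2
      then have "\<not> \<phi> n s" "\<not> \<phi> n r"
        using s le_refl[OF le_in(2)[OF s]] unfolding fNot_def by blast+
      then show ?thesis by simp
    qed
  next
    case False
    then show ?thesis using b[OF le_trans[OF s le_trans[OF r(1) q]]] by simp
  qed
  then show "\<exists>r. (r, q) \<in> le \<and> (\<exists>E. finite E \<and> (\<forall>s. (s, r) \<in> le \<longrightarrow> (\<forall>n. \<phi> n s \<longleftrightarrow> n \<in> E)))"
    using r(1) by (intro exI[of _ r] conjI exI[of _ "{n. n \<le> N \<and> \<phi> n r}"]) auto
qed

lemma not_fin_num_unbounded:
  assumes "(\<^bold>\<not> fin_num \<phi>) p" "\<And>n. regular (\<phi> n)" "(q, p) \<in> le"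
  obtains r n where "(r, q) \<in> le" "N < n" "\<phi> n r"
proof -
  have "\<not> fin_num \<phi> q" using assms(1,3) unfolding fNot_def by blast
  then have "\<not> (\<forall>n r. (r, q) \<in> le \<longrightarrow> N < n \<longrightarrow> \<not> \<phi> n r)"
    using fin_num_bounded[of \<phi> q N, OF assms(2)] by auto
  then show ?thesis using that by auto
qed

end

context forcing_poset
begin

section \<open>Maximality in the extension\<close>

lemma set_mem_checkE:
  assumes "set_mem x (check_family A) p" "p \<in> P"
  obtains r a where "(r, p) \<in> le" "a \<in> A" "set_eq x (up a) r"
proof -
  obtain r where "(r, p) \<in> le" "\<exists>a\<in>A. set_eq x (up a) r"
    using assms unfolding set_mem_check by (rule densely_at)
  then show ?thesis using that by auto
qed

text \<open>
  A finite set \<open>E\<close> of names for all members of \<open>A\<close> would assign, below one condition, names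
  from \<open>E\<close> to \<open>card E + 1\<close> members; two of them would then be forced to be equal.
\<close>

lemma not_fin_family_check:
  assumes "infinite A" "p \<in> P"
  shows "(\<^bold>\<not> fin_family (check_family A)) p"
  unfolding fNot_def
proof (intro allI impI notI)
  fix q assume q: "(q, p) \<in> le" and fin: "fin_family (check_family A) q"
  obtain r where r: "(r, q) \<in> le"
      and "\<exists>E\<in>{E. finite E \<and> E \<subseteq> set_names}. family_eq (check_family A) (up E) r"
    using fin unfolding fin_family_def fEx_eq by (rule densely_at[OF _ le_in(1)[OF q]])
  then obtain E where E: "finite E" "family_eq (check_family A) (up E) r" by auto
  have rP: "r \<in> P" using r by (rule le_in)
  have dens: "densely (\<lambda>s. \<exists>y\<in>E. set_eq (up a) y s) r" if "a \<in> A" for a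
  proof -
    have "(set_mem (up a) (check_family A) \<^bold>\<longleftrightarrow> set_mem (up a) (up E)) r"
      using E(2) up_in_set_names unfolding family_eq_def fAll_iff by simp
    then have "set_mem (up a) (check_family A) r \<longleftrightarrow> set_mem (up a) (up E) r"
      using le_refl[OF rP] by (simp add: fIff_iff)
    then show ?thesis
      using set_mem_checkI[OF that] unfolding set_mem_up by simp
  qed
  obtain T where T: "T \<subseteq> A" "finite T" "card T = Suc (card E)"
    using infinite_arbitrarily_large[OF assms(1), of "Suc (card E)"] by auto
  have "\<exists>s. (s, r) \<in> le \<and> (\<forall>a\<in>T. \<exists>y\<in>E. set_eq (up a) y s)"
  proof (rule densely_all_finite[OF T(2) rP])
    show "hereditary (\<lambda>s. \<exists>y\<in>E. set_eq (up a) y s)" for a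
      unfolding hereditary_def using set_eq_below by blast
    show "densely (\<lambda>s. \<exists>y\<in>E. set_eq (up a) y s) r" if "a \<in> T" for a
      using dens T(1) that by blast
  qed
  then obtain s where s: "(s, r) \<in> le" "\<forall>a\<in>T. \<exists>y\<in>E. set_eq (up a) y s" by auto
  then obtain g where g: "\<And>a. a \<in> T \<Longrightarrow> g a \<in> E \<and> set_eq (up a) (g a) s" by metis
  have "g ` T \<subseteq> E" using g by auto
  then have "card (g ` T) \<le> card E" using E(1) by (rule card_mono[rotated])
  then have "\<not> inj_on g T" using T(3) by (auto dest: card_image)
  then obtain a b where ab: "a \<in> T" "b \<in> T" "a \<noteq> b" "g a = g b" unfolding inj_on_def by auto
  have "set_eq (up a) (g b) s" "set_eq (up b) (g b) s"
    using g[OF ab(1)] g[OF ab(2)] unfolding ab(4) by simp_all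
  then have "set_eq (up a) (up b) s"
    using set_eq_trans set_eq_sym by blast
  then show False using set_eq_up[OF le_in(1)[OF s(1)]] ab(3) by blast
qed

lemma regular_fin_set [simp]: "regular (fin_set x)"
  unfolding fin_set_def by simp

lemma almost_disjoint_check:
  assumes A: "almost_disjoint_family A" and p: "p \<in> P"
  shows "f_almost_disjoint_family (check_family A) p"
  unfolding f_almost_disjoint_family_def
proof (intro fAndI fAllI)
  show "(\<^bold>\<not> fin_family (check_family A)) p"
    using A p not_fin_family_check unfolding almost_disjoint_family_def by blast
next
  fix x
  show "(set_mem x (check_family A) \<^bold>\<longrightarrow> (\<^bold>\<not> fin_set x)) p"
  proof (rule fImpI)
    fix q assume q: "(q, p) \<in> le" and x: "set_mem x (check_family A) q"
    show "(\<^bold>\<not> fin_set x) q"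
      unfolding fNot_def
    proof (intro allI impI notI)
      fix r assume r: "(r, q) \<in> le" and fin: "fin_set x r"
      obtain s E where s: "(s, r) \<in> le" "finite E" "\<And>t n. (t, s) \<in> le \<Longrightarrow> num_mem n x t \<longleftrightarrow> n \<in> E"
        using fin unfolding fin_set_def by (rule fin_numE[OF _ _ le_in(1)[OF r]]) simp_all
      have "set_mem x (check_family A) s"
        using hereditaryD[OF regular_hereditary[OF regular_set_mem] x le_trans[OF s(1) r]] .
      then obtain t a where t: "(t, s) \<in> le" "a \<in> A" "set_eq x (up a) t"
        using le_in(1)[OF s(1)] by (rule set_mem_checkE)
      have tP: "t \<in> P" using t(1) by (rule le_in)
      have "n \<in> a \<longleftrightarrow> n \<in> E" for n
        using s(3)[OF t(1)] set_eq_at[OF t(3) tP] num_mem_up[OF tP] by simp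
      then have "a = E" by blast
      then show False using A t(2) s(2) unfolding almost_disjoint_family_def by blast
    qed
  qed
next
  fix x y
  show "(set_mem x (check_family A) \<^bold>\<and> set_mem y (check_family A) \<^bold>\<and> (\<^bold>\<not> set_eq x y) \<^bold>\<longrightarrow>
          fin_num (\<lambda>n. num_mem n x \<^bold>\<and> num_mem n y)) p"
  proof (rule fImpI)
    fix q assume q: "(q, p) \<in> le"
      and "(set_mem x (check_family A) \<^bold>\<and> set_mem y (check_family A) \<^bold>\<and> (\<^bold>\<not> set_eq x y)) q"
    then have x: "set_mem x (check_family A) q" and y: "set_mem y (check_family A) q"
      and ne: "(\<^bold>\<not> set_eq x y) q"
      by (simp_all add: fAnd_iff)
    have reg: "regular (num_mem n x \<^bold>\<and> num_mem n y)" for n by simp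
    show "fin_num (\<lambda>n. num_mem n x \<^bold>\<and> num_mem n y) q"
      unfolding fin_num_iff[OF reg]
    proof (rule denselyI)
      fix r assume r: "(r, q) \<in> le"
      obtain s a where s: "(s, r) \<in> le" "a \<in> A" "set_eq x (up a) s"
        using hereditaryD[OF regular_hereditary[OF regular_set_mem] x r] le_in(1)[OF r]
        by (rule set_mem_checkE)
      obtain t b where t: "(t, s) \<in> le" "b \<in> A" "set_eq y (up b) t"
        using hereditaryD[OF regular_hereditary[OF regular_set_mem] y le_trans[OF s(1) r]] le_in(1)[OF s(1)]
        by (rule set_mem_checkE)
      have xt: "set_eq x (up a) t" by (rule set_eq_below[OF s(3) t(1)])
      have tr: "(t, r) \<in> le" by (rule le_trans[OF t(1) s(1)])
      have "a \<noteq> b"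
      proof
        assume "a = b"
        then have "set_eq x y t" using set_eq_trans[OF xt] set_eq_sym[OF t(3)] by simp
        then show False using ne le_trans[OF tr r] unfolding fNot_def by simp
      qed
      then have fin: "finite (a \<inter> b)" using A s(2) t(2) unfolding almost_disjoint_family_def by simp
      have "(num_mem n x \<^bold>\<and> num_mem n y) u \<longleftrightarrow> n \<in> a \<inter> b" if u: "(u, t) \<in> le" for u n
      proof -
        have uP: "u \<in> P" using u by (rule le_in)
        show ?thesis
          using set_eq_at[OF set_eq_below[OF xt u] uP] set_eq_at[OF set_eq_below[OF t(3) u] uP]
            num_mem_up[OF uP] by (simp add: fAnd_iff)
      qed
      then show "\<exists>s. (s, r) \<in> le \<and> (\<exists>E. finite E \<and>
          (\<forall>u. (u, s) \<in> le \<longrightarrow> (\<forall>n. (num_mem n x \<^bold>\<and> num_mem n y) u \<longleftrightarrow> n \<in> E)))"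
        using tr fin by (intro exI[of _ t] conjI exI[of _ "a \<inter> b"]) simp_all
    qed
  qed
qed

text \<open>
  Suppose a condition \<open>t\<close> forces that \<open>x\<close> belongs to a larger almost disjoint family
  but not to \<open>A\<close>.  The pairs of a condition \<open>u\<close> below \<open>t\<close> and a number \<open>n\<close> with \<open>u\<close> forcing
  \<open>n \<in> x\<close> form an approximation to the sequence of singletons of elements of \<open>x\<close>.
  As \<open>A\<close> absorbs it, some \<open>a \<in> A\<close> is forced by a stronger condition to have infinite
  intersection with \<open>x\<close>, which contradicts almost disjointness.
\<close>

lemma mad_check:
  assumes A: "almost_disjoint_family A" and abs: "absorbing P le A" and p: "p \<in> P"
  shows "f_mad (check_family A) p"
  unfolding f_mad_def
proof (rule fAndI)
  show "f_almost_disjoint_family (check_family A) p" by (rule almost_disjoint_check[OF A p])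
  let ?A = "check_family A"
  show "(\<^bold>\<not> fEx family_names (\<lambda>Y. f_almost_disjoint_family Y \<^bold>\<and> family_subset ?A Y \<^bold>\<and> (\<^bold>\<not> family_eq ?A Y))) p"
    unfolding fNot_def[of "fEx _ _"]
  proof (intro allI impI notI)
    fix q assume q: "(q, p) \<in> le" and
      ex: "fEx family_names (\<lambda>Y. f_almost_disjoint_family Y \<^bold>\<and> family_subset ?A Y \<^bold>\<and> (\<^bold>\<not> family_eq ?A Y)) q"
    obtain r where r: "(r, q) \<in> le" and "\<exists>Y\<in>family_names.
        (f_almost_disjoint_family Y \<^bold>\<and> family_subset ?A Y \<^bold>\<and> (\<^bold>\<not> family_eq ?A Y)) r"
      using ex unfolding fEx_eq by (rule densely_at[OF _ le_in(1)[OF q]])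
    then obtain Y where Y: "f_almost_disjoint_family Y r" "family_subset ?A Y r" "(\<^bold>\<not> family_eq ?A Y) r"
      unfolding fAnd_iff by auto
    have rP: "r \<in> P" using r by (rule le_in)
    have sub: "set_mem x Y s" if "(s, r) \<in> le" "x \<in> set_names" "set_mem x ?A s" for x s
    proof -
      have "(set_mem x ?A \<^bold>\<longrightarrow> set_mem x Y) r"
        using Y(2) that(2) unfolding family_subset_def fAll_iff by simp
      then show ?thesis using that(1,3) by (rule fImpD) simp_all
    qed
    have "\<not> family_eq ?A Y r" using Y(3) le_refl[OF rP] unfolding fNot_def by simp
    then obtain x s where x: "x \<in> set_names" "(s, r) \<in> le" "\<not> (set_mem x ?A s \<longleftrightarrow> set_mem x Y s)"
      unfolding family_eq_def fAll_iff by (auto simp: fIff_iff)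
    have xY: "set_mem x Y s" and xA: "\<not> set_mem x ?A s" using x sub by auto
    have sP: "s \<in> P" using x(2) by (rule le_in)
    have "\<not> densely (set_mem x ?A) s" using xA regularD[OF regular_set_mem sP] by auto
    then obtain t where t: "(t, s) \<in> le" "\<And>u. (u, t) \<in> le \<Longrightarrow> \<not> set_mem x ?A u"
      unfolding densely_def by auto
    have tP: "t \<in> P" and tr: "(t, r) \<in> le" using le_in(1)[OF t(1)] le_trans[OF t(1) x(2)] by auto
    have Yt: "set_mem x Y u" if "(u, t) \<in> le" for u
      using hereditaryD[OF regular_hereditary[OF regular_set_mem] xY le_trans[OF that t(1)]] .
    have inf: "(\<^bold>\<not> fin_num (\<lambda>n. num_mem n x)) t"
    proof -
      have "(set_mem x Y \<^bold>\<longrightarrow> (\<^bold>\<not> fin_set x)) r"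
        using Y(1) x(1) unfolding f_almost_disjoint_family_def fAnd_iff fAll_iff by simp
      then have "(\<^bold>\<not> fin_set x) t"
        using tr Yt[OF le_refl[OF tP]] by (rule fImpD) (simp_all add: regular_fNot regular_hereditary)
      then show ?thesis unfolding fin_set_def .
    qed
    define K where "K = {(u, n, D). (u, t) \<in> le \<and> num_mem n x u \<and> D = {n}}"
    have "frequent le K t"
      unfolding frequent_def
    proof (intro allI impI)
      fix u n assume u: "(u, t) \<in> le"
      obtain v m where v: "(v, u) \<in> le" "n < m" "num_mem m x v"
        using inf by (rule not_fin_num_unbounded[OF _ _ u]) simp_all
      then have "(v, m, {m}) \<in> K" unfolding K_def using le_trans[OF v(1) u] by simp
      then have "{m} \<in> late_values le K u n" using v unfolding late_values_def by auto
      then show "late_values le K u n \<noteq> {}" by auto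
    qed
    moreover have "approximates P le K"
      unfolding approximates_def
    proof (intro conjI allI impI)
      show "K \<subseteq> P \<times> UNIV \<times> {D. finite D \<and> D \<noteq> {}}" unfolding K_def using le_in(1) by auto
      show "downward le K"
        unfolding downward_def
      proof (intro allI impI)
        fix u n D v assume u: "(u, n, D) \<in> K" and v: "(v, u) \<in> le"
        have "num_mem n x v"
          using u hereditaryD[OF regular_hereditary[OF regular_num_mem] _ v] unfolding K_def by simp
        then show "(v, n, D) \<in> K" using u le_trans[OF v] unfolding K_def by simp
      qed
    qed (auto simp: K_def)
    ultimately have "\<exists>q' K' S. (q', t) \<in> le \<and> captures le A K q' K' S"
      by (intro absorbingD[OF abs tP])
    then obtain q1 K1 S where q1: "(q1, t) \<in> le" and cap: "captures le A K q1 K1 S" by auto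
    have q1P: "q1 \<in> P" and q1r: "(q1, r) \<in> le" using le_in(1)[OF q1] le_trans[OF q1 tr] by auto
    obtain a where a: "a \<in> A" "frequent le (hitting {a} K1) q1" using capturesD(6)[OF cap] by auto
    have ne: "(\<^bold>\<not> set_eq x (up a)) q1"
      unfolding fNot_def
    proof (intro allI impI notI)
      fix u assume u: "(u, q1) \<in> le" and eq: "set_eq x (up a) u"
      have "set_mem x ?A u"
        unfolding set_mem_check
      proof (intro denselyI)
        fix v assume v: "(v, u) \<in> le"
        then have "set_eq x (up a) v" using set_eq_below eq by simp
        then show "\<exists>w. (w, v) \<in> le \<and> (\<exists>a\<in>A. set_eq x (up a) w)"
          using a(1) le_refl[OF le_in(1)[OF v]] by (intro exI[of _ v]) auto
      qed
      then show False using t(2) le_trans[OF u q1] by blast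
    qed
    have imp: "(set_mem x Y \<^bold>\<and> set_mem (up a) Y \<^bold>\<and> (\<^bold>\<not> set_eq x (up a)) \<^bold>\<longrightarrow>
          fin_num (\<lambda>n. num_mem n x \<^bold>\<and> num_mem n (up a))) r"
      using Y(1) x(1) up_in_set_names unfolding f_almost_disjoint_family_def fAnd_iff fAll_iff by simp
    have ant: "(set_mem x Y \<^bold>\<and> set_mem (up a) Y \<^bold>\<and> (\<^bold>\<not> set_eq x (up a))) q1"
      unfolding fAnd_iff using Yt[OF q1] sub[OF q1r up_in_set_names set_mem_checkI[OF a(1)]] ne by simp
    have "fin_num (\<lambda>n. num_mem n x \<^bold>\<and> num_mem n (up a)) q1"
      by (rule fImpD[OF imp q1r ant]) (simp_all add: regular_fNot regular_hereditary)
    then obtain v E where v: "(v, q1) \<in> le" "finite E"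
        "\<And>w n. (w, v) \<in> le \<Longrightarrow> (num_mem n x \<^bold>\<and> num_mem n (up a)) w \<longleftrightarrow> n \<in> E"
      by (rule fin_numE[OF _ _ q1P]) simp_all
    have "late_values le (hitting {a} K1) v (Max (insert 0 E)) \<noteq> {}"
      using a(2) v(1) unfolding frequent_def by simp
    then obtain w n D where w: "(w, n, D) \<in> hitting {a} K1" "(w, v) \<in> le" "Max (insert 0 E) < n"
      unfolding late_values_def by auto
    have "(w, n, D) \<in> K" "D \<inter> a \<noteq> {}"
      using w(1) capturesD(1)[OF cap] unfolding hitting_def by auto
    then have "num_mem n x w" "n \<in> a" unfolding K_def by auto
    then have "n \<in> E" using v(3)[OF w(2), of n] num_mem_up[OF le_in(1)[OF w(2)]] by (simp add: fAnd_iff)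
    then show False using w(3) v(2) by (meson Max_ge finite.insertI insertI2 not_le)
  qed
qed

end

context forcing_poset
begin

section \<open>The fin-intersecting property in the extension\<close>

lemma regular_infinite_trace [simp]: "regular (infinite_trace X C I x)"
proof -
  have "regular (fAll UNIV (\<lambda>n. num_mem n x \<^bold>\<longrightarrow> num_mem n I) \<^bold>\<and> fin_set x)"
    by (simp add: regular_hereditary)
  then show ?thesis
    unfolding infinite_trace_def by (rule regular_fAnd[OF regular_fEx regular_fNot[OF regular_hereditary]])
qed

lemma meets_up:
  assumes "\<And>s n. (s, r) \<in> le \<Longrightarrow> num_mem n y s \<longleftrightarrow> n \<in> D" "r \<in> P"
  shows "meets (up a) y r \<longleftrightarrow> a \<inter> D \<noteq> {}"
proof -
  have "(\<exists>n\<in>UNIV. (num_mem n (up a) \<^bold>\<and> num_mem n y) s) \<longleftrightarrow> a \<inter> D \<noteq> {}" if "(s, r) \<in> le" for s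
    unfolding fAnd_iff num_mem_up[OF le_in(1)[OF that]] using assms(1)[OF that] by auto
  moreover have "(r, r) \<in> le" using assms(2) by (rule le_refl)
  ultimately show ?thesis
    unfolding meets_def fEx_eq densely_def using le_in le_refl le_trans by (metis (no_types, lifting))
qed

lemma meets_cong:
  assumes "set_eq a b r"
  shows "meets a y r \<longleftrightarrow> meets b y r"
proof -
  have "(\<exists>n\<in>UNIV. (num_mem n a \<^bold>\<and> num_mem n y) s) \<longleftrightarrow> (\<exists>n\<in>UNIV. (num_mem n b \<^bold>\<and> num_mem n y) s)"
    if "(s, r) \<in> le" for s
    using set_eq_at[OF set_eq_below[OF assms that] le_in(1)[OF that]] unfolding fAnd_iff by simp
  then show ?thesis
    unfolding meets_def fEx_eq densely_def using le_trans by (metis (no_types, lifting))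
qed

lemma hereditary_f_fin_sequence: "hereditary (f_fin_sequence C)"
proof -
  have "regular (\<^bold>\<not> meets (C n) (C m))" for n m
    by (rule regular_fNot) (simp add: regular_hereditary)
  then have "regular (f_fin_sequence C)"
    unfolding f_fin_sequence_def by (simp add: regular_hereditary)
  then show ?thesis by (rule regular_hereditary)
qed

text \<open>
  The triples record what is decided about \<open>C\<close> below \<open>q\<close>: every condition below \<open>r\<close> agrees on
  \<open>C(k)\<close>.
\<close>

definition approximation_of :: "(nat \<Rightarrow> 'p set_name) \<Rightarrow> 'p \<Rightarrow> 'p approximation" where
  "approximation_of C q = {(r, k, D). (r, q) \<in> le \<and> finite D \<and> D \<noteq> {} \<and>
     (\<forall>s n. (s, r) \<in> le \<longrightarrow> (num_mem n (C k) s \<longleftrightarrow> n \<in> D))}"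

lemma approximates_approximation_of:
  assumes "f_fin_sequence C q"
  shows "approximates P le (approximation_of C q)"
  unfolding approximates_def
proof (intro conjI allI impI)
  show "approximation_of C q \<subseteq> P \<times> UNIV \<times> {D. finite D \<and> D \<noteq> {}}"
    unfolding approximation_of_def using le_in(1) by auto
  show "downward le (approximation_of C q)"
    unfolding downward_def
  proof (intro allI impI)
    fix s k D r assume s: "(s, k, D) \<in> approximation_of C q" and r: "(r, s) \<in> le"
    then have "(r, q) \<in> le" "\<And>t. (t, r) \<in> le \<Longrightarrow> (t, s) \<in> le"
      using le_trans[OF r] le_trans[OF _ r] unfolding approximation_of_def by auto
    then show "(r, k, D) \<in> approximation_of C q"
      using s unfolding approximation_of_def by simp
  qed
next
  fix s k D s' k' D'
  assume s: "(s, k, D) \<in> approximation_of C q" "(s', k', D') \<in> approximation_of C q"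
    "(s', s) \<in> le" "D \<inter> D' \<noteq> {}"
  obtain x where x: "x \<in> D" "x \<in> D'" using s(4) by blast
  have s'P: "s' \<in> P" using s(3) by (rule le_in)
  have s'q: "(s', q) \<in> le" using s(2) unfolding approximation_of_def by simp
  have mem: "num_mem x (C k) s'" "num_mem x (C k') s'"
    using s(1-3) x le_refl[OF s'P] unfolding approximation_of_def by auto
  show "k = k'"
  proof (rule ccontr)
    assume "k \<noteq> k'"
    have imp: "(ground (k \<noteq> k') \<^bold>\<longrightarrow> (\<^bold>\<not> meets (C k) (C k'))) q"
      using assms unfolding f_fin_sequence_def fAnd_iff fAll_iff by simp
    have "ground (k \<noteq> k') s'" using \<open>k \<noteq> k'\<close> unfolding ground_def .
    then have "(\<^bold>\<not> meets (C k) (C k')) s'"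
      by (rule fImpD[OF imp s'q]) (simp_all add: regular_fNot regular_hereditary)
    moreover have "meets (C k) (C k') s'"
      unfolding meets_def fEx_eq
    proof (rule denselyI)
      fix t assume t: "(t, s') \<in> le"
      have "num_mem x (C k) t" "num_mem x (C k') t"
        using mem hereditaryD[OF regular_hereditary[OF regular_num_mem] _ t] by auto
      then show "\<exists>r. (r, t) \<in> le \<and> (\<exists>n\<in>UNIV. (num_mem n (C k) \<^bold>\<and> num_mem n (C k')) r)"
        using le_refl[OF le_in(1)[OF t]] unfolding fAnd_iff by auto
    qed
    ultimately show False using le_refl[OF s'P] unfolding fNot_def by simp
  qed
qed

lemma frequent_approximation_of:
  assumes "f_fin_sequence C q"
  shows "frequent le (approximation_of C q) q"
  unfolding frequent_def
proof (intro allI impI)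
  fix q' n assume q': "(q', q) \<in> le"
  have seq: "fin_set (C (Suc n)) q" "fEx UNIV (\<lambda>k. num_mem k (C (Suc n))) q"
    using assms unfolding f_fin_sequence_def fAnd_iff fAll_iff by simp_all
  have "fin_set (C (Suc n)) q'"
    using hereditaryD[OF regular_hereditary[OF regular_fin_set] seq(1) q'] .
  then obtain r D where r: "(r, q') \<in> le" "finite D" "\<And>s k. (s, r) \<in> le \<Longrightarrow> num_mem k (C (Suc n)) s \<longleftrightarrow> k \<in> D"
    unfolding fin_set_def by (rule fin_numE[OF _ _ le_in(1)[OF q']]) simp_all
  have rq: "(r, q) \<in> le" by (rule le_trans[OF r(1) q'])
  obtain s where s: "(s, r) \<in> le" "\<exists>k\<in>UNIV. num_mem k (C (Suc n)) s"
    using seq(2) rq unfolding fEx_eq by (rule denselyE)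
  then have "D \<noteq> {}" using r(3) by auto
  then have "(r, Suc n, D) \<in> approximation_of C q"
    unfolding approximation_of_def using rq r(2,3) by simp
  then have "D \<in> late_values le (approximation_of C q) q' n"
    unfolding late_values_def using r(1) by auto
  then show "late_values le (approximation_of C q) q' n \<noteq> {}" by auto
qed

lemma fin_familyE:
  assumes "fin_family F p" "p \<in> P"
  obtains r E where "(r, p) \<in> le" "finite E" "E \<subseteq> set_names" "family_eq F (up E) r"
proof -
  obtain r where r: "(r, p) \<in> le" "\<exists>E\<in>{E. finite E \<and> E \<subseteq> set_names}. family_eq F (up E) r"
    using assms unfolding fin_family_def fEx_eq by (rule densely_at)
  then show ?thesis using that[OF r(1)] by auto
qed

lemma family_eq_at:
  assumes "family_eq F G p" "x \<in> set_names" "(q, p) \<in> le"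
  shows "set_mem x F q \<longleftrightarrow> set_mem x G q"
proof -
  have "(set_mem x F \<^bold>\<longleftrightarrow> set_mem x G) p"
    using assms(1,2) unfolding family_eq_def fAll_iff by simp
  then show ?thesis using assms(3) by (simp add: fIff_iff)
qed

lemma regular_fin_family: "regular (fin_family X)"
  unfolding fin_family_def by simp

text \<open>
  The name of the set of those \<open>k\<close> for which some \<open>(r, k, D) \<in> K\<close> has \<open>r\<close> in the generic
  filter.
\<close>

definition index_name :: "'p approximation \<Rightarrow> 'p set_name" where
  "index_name K = {(k, r). \<exists>D. (r, k, D) \<in> K}"

lemma num_mem_index_name: "(r, k, D) \<in> K \<Longrightarrow> num_mem k (index_name K) r"
  unfolding num_mem_eq index_name_def using le_refl le_in(1) by (intro denselyI) blast

lemma num_mem_index_nameE: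
  assumes "num_mem k (index_name K) r" "r \<in> P" "downward le K"
  obtains s D where "(s, r) \<in> le" "(s, k, D) \<in> K"
proof -
  obtain s where s: "(s, r) \<in> le" "\<exists>t. (k, t) \<in> index_name K \<and> (s, t) \<in> le"
    using assms(1,2) unfolding num_mem_eq by (rule densely_at)
  then obtain t D where "(t, k, D) \<in> K" "(s, t) \<in> le" unfolding index_name_def by auto
  then have "(s, k, D) \<in> K" using assms(3) unfolding downward_def by blast
  then show ?thesis using that s(1) by blast
qed

text \<open>
  A finite set of infinite traces is given, below a suitable condition \<open>s\<close>, by a finite set
  \<open>T\<close> of names, and each \<open>x \<in> T\<close> is the trace of some \<open>b x \<in> A\<close> of the ground model.
  If \<open>b x\<close> is outside \<open>S\<close>, it is settled; being infinite, the trace then contains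
  all large elements of the index set.  The remaining \<open>b x\<close> belong to \<open>S\<close>, so
  arbitrarily large indices \<open>k\<close> below \<open>s\<close> occur with a term met by all of them.
  Such \<open>k\<close> lie in every trace.
\<close>

lemma centered_index_name:
  assumes K: "K \<subseteq> approximation_of C q0" and cap: "captures le A K0 q K S" and q: "q \<in> P"
  shows "f_centered (infinite_trace (check_family A) C (index_name K)) q"
proof -
  let ?I = "index_name K"
  have down: "downward le K" by (rule capturesD(2)[OF cap])
  \<comment> \<open>Below \<open>r\<close>, the name \<open>x\<close> is the trace of some \<open>a \<in> A\<close>, and \<open>a\<close> belongs to \<open>S\<close>
    or meets all late terms.\<close>
  define good where "good x r \<longleftrightarrow> (\<exists>a\<in>A. (\<forall>s n. (s, r) \<in> le \<longrightarrow> (num_mem n x s \<longleftrightarrow> num_mem n ?I s \<and> meets (up a) (C n) s)) \<and>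
      (a \<in> S \<or> (\<exists>N. \<forall>D\<in>late_values le K r N. D \<inter> a \<noteq> {})))" for x r
  have her: "hereditary (good x)" for x
    unfolding hereditary_def
  proof (intro allI impI)
    fix r s assume "good x r" and s: "(s, r) \<in> le"
    then obtain a where a: "a \<in> A" "\<forall>t n. (t, r) \<in> le \<longrightarrow> (num_mem n x t \<longleftrightarrow> num_mem n ?I t \<and> meets (up a) (C n) t)"
      "a \<in> S \<or> (\<exists>N. \<forall>D\<in>late_values le K r N. D \<inter> a \<noteq> {})" unfolding good_def by auto
    have "\<forall>t n. (t, s) \<in> le \<longrightarrow> (num_mem n x t \<longleftrightarrow> num_mem n ?I t \<and> meets (up a) (C n) t)"
      using a(2) le_trans[OF _ s] by simp
    moreover have "a \<in> S \<or> (\<exists>N. \<forall>D\<in>late_values le K s N. D \<inter> a \<noteq> {})"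
      using a(3) late_values_below[OF s] by (meson subsetD)
    ultimately show "good x s" unfolding good_def using a(1) by auto
  qed
  have meets_K: "meets (up a) (C k) s \<longleftrightarrow> a \<inter> D \<noteq> {}" if "(s, k, D) \<in> K" for s k D a
  proof (rule meets_up)
    have "(s, k, D) \<in> approximation_of C q0" using K that by blast
    then show "s \<in> P" "\<And>t n. (t, s) \<in> le \<Longrightarrow> num_mem n (C k) t \<longleftrightarrow> n \<in> D"
      unfolding approximation_of_def using le_in(1) by auto
  qed
  have trace_good: "densely (good x) r"
    if tr: "infinite_trace (check_family A) C ?I x r" and r: "(r, q) \<in> le" for x r
  proof (rule denselyI)
    fix u assume u: "(u, r) \<in> le"
    have "infinite_trace (check_family A) C ?I x u"
      using hereditaryD[OF regular_hereditary[OF regular_infinite_trace] tr u] .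
    then have ex: "fEx set_names (\<lambda>a. set_mem a (check_family A) \<^bold>\<and>
          fAll UNIV (\<lambda>n. num_mem n x \<^bold>\<longleftrightarrow> num_mem n ?I \<^bold>\<and> meets a (C n))) u"
      and inf: "(\<^bold>\<not> (fAll UNIV (\<lambda>n. num_mem n x \<^bold>\<longrightarrow> num_mem n ?I) \<^bold>\<and> fin_set x)) u"
      unfolding infinite_trace_def by (simp_all add: fAnd_def)
    obtain v where v: "(v, u) \<in> le" "\<exists>a\<in>set_names. (set_mem a (check_family A) \<^bold>\<and>
          fAll UNIV (\<lambda>n. num_mem n x \<^bold>\<longleftrightarrow> num_mem n ?I \<^bold>\<and> meets a (C n))) v"
      using ex le_in(1)[OF u] unfolding fEx_eq by (rule densely_at)
    then obtain a' where a': "set_mem a' (check_family A) v"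
        "\<And>n. (num_mem n x \<^bold>\<longleftrightarrow> num_mem n ?I \<^bold>\<and> meets a' (C n)) v"
      by (auto simp: fAnd_iff fAll_iff)
    obtain w a where w: "(w, v) \<in> le" "a \<in> A" "set_eq a' (up a) w"
      using a'(1) le_in(1)[OF v(1)] by (rule set_mem_checkE)
    have iff: "num_mem n x s \<longleftrightarrow> num_mem n ?I s \<and> meets (up a) (C n) s" if s: "(s, w) \<in> le" for s n
    proof -
      have "num_mem n x s \<longleftrightarrow> (num_mem n ?I \<^bold>\<and> meets a' (C n)) s"
        using a'(2)[of n] le_trans[OF s w(1)] by (simp add: fIff_iff)
      then show ?thesis
        using meets_cong[OF set_eq_below[OF w(3) s]] by (simp add: fAnd_iff)
    qed
    have wu: "(w, u) \<in> le" by (rule le_trans[OF w(1) v(1)])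
    have wq: "(w, q) \<in> le" by (rule le_trans[OF wu le_trans[OF u r]])
    show "\<exists>r. (r, u) \<in> le \<and> good x r"
    proof (cases "a \<in> S")
      case True
      then have "good x w" unfolding good_def using iff w(2) by auto
      then show ?thesis using wu by blast
    next
      case False
      obtain t where t: "(t, w) \<in> le" "settles le K a t"
        using capturesD(5)[OF cap w(2) False wq] by blast
      have tP: "t \<in> P" using t(1) by (rule le_in)
      obtain N where N: "(\<forall>D\<in>late_values le K t N. D \<inter> a \<noteq> {}) \<or> (\<forall>D\<in>late_values le K t N. D \<inter> a = {})"
        using t(2) unfolding settles_def by blast
      have "\<not> (\<forall>D\<in>late_values le K t N. D \<inter> a = {})"
      proof
        \<comment> \<open>Missing all late terms would bound the trace, which is infinite.\<close>
        assume miss: "\<forall>D\<in>late_values le K t N. D \<inter> a = {}"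
        have no: "\<not> num_mem n x s" if s: "(s, t) \<in> le" and n: "N < n" for s n
        proof
          assume "num_mem n x s"
          then have m: "num_mem n ?I s" "meets (up a) (C n) s" using iff[OF le_trans[OF s t(1)]] by auto
          obtain s' D where s': "(s', s) \<in> le" "(s', n, D) \<in> K"
            using m(1) le_in(1)[OF s] down by (rule num_mem_index_nameE)
          have "meets (up a) (C n) s'"
            using hereditaryD[OF regular_hereditary[OF regular_meets] m(2) s'(1)] .
          then have "a \<inter> D \<noteq> {}" using meets_K[OF s'(2)] by simp
          moreover have "D \<in> late_values le K t N"
            unfolding late_values_def using s'(2) le_trans[OF s'(1) s] n by auto
          ultimately show False using miss by blast
        qed
        have "fin_set x t"
          unfolding fin_set_def by (rule fin_num_bounded[of "\<lambda>n. num_mem n x", OF _ no]) simp_all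
        moreover have "fAll UNIV (\<lambda>n. num_mem n x \<^bold>\<longrightarrow> num_mem n ?I) t"
          by (intro fAllI fImpI) (use iff le_trans[OF _ t(1)] in blast)
        ultimately have "(fAll UNIV (\<lambda>n. num_mem n x \<^bold>\<longrightarrow> num_mem n ?I) \<^bold>\<and> fin_set x) t"
          by (simp add: fAnd_def)
        then show False using inf le_trans[OF t(1) wu] unfolding fNot_def by simp
      qed
      then have "\<exists>N. \<forall>D\<in>late_values le K t N. D \<inter> a \<noteq> {}" using N by blast
      then have "good x t" unfolding good_def using w(2) iff le_trans[OF _ t(1)] by blast
      then show ?thesis using le_trans[OF t(1) wu] by blast
    qed
  qed
  show ?thesis
    unfolding f_centered_def
  proof (intro fAllI fImpI)
    fix F r assume r: "(r, q) \<in> le"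
      and "(fAll set_names (\<lambda>x. set_mem x F \<^bold>\<longrightarrow> infinite_trace (check_family A) C ?I x) \<^bold>\<and>
        fin_family F \<^bold>\<and> fEx set_names (\<lambda>x. set_mem x F)) r"
    then have tr: "\<And>x. x \<in> set_names \<Longrightarrow> (set_mem x F \<^bold>\<longrightarrow> infinite_trace (check_family A) C ?I x) r"
      and fin: "fin_family F r"
      by (simp_all add: fAnd_iff fAll_iff)
    show "(\<^bold>\<not> fin_num (\<lambda>n. fAll set_names (\<lambda>x. set_mem x F \<^bold>\<longrightarrow> num_mem n x))) r"
      unfolding fNot_def
    proof (intro allI impI notI)
      fix r1 assume r1: "(r1, r) \<in> le" and "fin_num (\<lambda>n. fAll set_names (\<lambda>x. set_mem x F \<^bold>\<longrightarrow> num_mem n x)) r1"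
      then obtain r2 E where r2: "(r2, r1) \<in> le" "finite E"
        "\<And>s n. (s, r2) \<in> le \<Longrightarrow> fAll set_names (\<lambda>x. set_mem x F \<^bold>\<longrightarrow> num_mem n x) s \<longleftrightarrow> n \<in> E"
        by (elim fin_numE[OF _ _ le_in(1)[OF r1]]) (simp_all add: regular_hereditary)
      have r2r: "(r2, r) \<in> le" by (rule le_trans[OF r2(1) r1])
      have "fin_family F r2"
        by (rule hereditaryD[OF regular_hereditary[OF regular_fin_family] fin r2r])
      then obtain r3 T where r3: "(r3, r2) \<in> le" and T: "finite T" "T \<subseteq> set_names" "family_eq F (up T) r3"
        using le_in(1)[OF r2(1)] by (rule fin_familyE)
      have r3P: "r3 \<in> P" and r3r: "(r3, r) \<in> le" and r3q: "(r3, q) \<in> le"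
        using le_in(1)[OF r3] le_trans[OF r3 r2r] le_trans[OF le_trans[OF r3 r2r] r] by auto
      have "\<exists>s. (s, r3) \<in> le \<and> (\<forall>x\<in>T. good x s)"
      proof (rule densely_all_finite[OF T(1) r3P her])
        fix x assume x: "x \<in> T"
        then have xs: "x \<in> set_names" using T(2) by blast
        have "set_mem x F r3"
          using family_eq_at[OF T(3) xs le_refl[OF r3P]] set_mem_up_self[OF x] by simp
        then have "infinite_trace (check_family A) C ?I x r3"
          by (rule fImpD[OF tr[OF xs] r3r]) simp_all
        then show "densely (good x) r3" using r3q by (rule trace_good)
      qed
      then obtain s where s: "(s, r3) \<in> le" "\<forall>x\<in>T. good x s" by blast
      have "\<exists>b. \<forall>x\<in>T. b x \<in> A \<and>
        (\<forall>t n. (t, s) \<in> le \<longrightarrow> (num_mem n x t \<longleftrightarrow> num_mem n ?I t \<and> meets (up (b x)) (C n) t)) \<and>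
        (b x \<in> S \<or> (\<exists>N. \<forall>D\<in>late_values le K s N. D \<inter> b x \<noteq> {}))"
        using s(2) unfolding good_def by (intro bchoice) (simp add: Bex_def)
      then obtain b where b0: "\<forall>x\<in>T. b x \<in> A \<and>
        (\<forall>t n. (t, s) \<in> le \<longrightarrow> (num_mem n x t \<longleftrightarrow> num_mem n ?I t \<and> meets (up (b x)) (C n) t)) \<and>
        (b x \<in> S \<or> (\<exists>N. \<forall>D\<in>late_values le K s N. D \<inter> b x \<noteq> {}))"
        by (elim exE)
      have b_trace: "num_mem n x t \<longleftrightarrow> num_mem n ?I t \<and> meets (up (b x)) (C n) t"
        if "x \<in> T" "(t, s) \<in> le" for x t n
        using bspec[OF b0 that(1)] that(2) by blast
      have b_hit: "b x \<in> S \<or> (\<exists>N. \<forall>D\<in>late_values le K s N. D \<inter> b x \<noteq> {})" if "x \<in> T" for x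
        using bspec[OF b0 that] by (elim conjE)
      have "\<exists>M. \<forall>x\<in>T. b x \<notin> S \<longrightarrow> (\<forall>D\<in>late_values le K s M. D \<inter> b x \<noteq> {})"
        using T(1) b_hit
      proof (induction T rule: finite_induct)
        case empty
        show ?case by simp
      next
        case (insert x T)
        obtain M where M: "\<forall>x\<in>T. b x \<notin> S \<longrightarrow> (\<forall>D\<in>late_values le K s M. D \<inter> b x \<noteq> {})"
          using insert.IH insert.prems by auto
        obtain N where N: "b x \<notin> S \<longrightarrow> (\<forall>D\<in>late_values le K s N. D \<inter> b x \<noteq> {})"
          using insert.prems[of x] by auto
        have "late_values le K s (max M N) \<subseteq> late_values le K s M" "late_values le K s (max M N) \<subseteq> late_values le K s N"
          by (simp_all add: late_values_mono)
        then have "\<forall>y\<in>insert x T. b y \<notin> S \<longrightarrow> (\<forall>D\<in>late_values le K s (max M N). D \<inter> b y \<noteq> {})"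
          using M N by auto
        then show ?case by (rule exI)
      qed
      then obtain M where M: "\<forall>x\<in>T. b x \<notin> S \<longrightarrow> (\<forall>D\<in>late_values le K s M. D \<inter> b x \<noteq> {})"
        by (elim exE)
      define F' where "F' = b ` T \<inter> S"
      have "frequent le (hitting F' K) q"
        by (rule capturesD(4)[OF cap]) (use T(1) in \<open>simp_all add: F'_def\<close>)
      moreover have sq: "(s, q) \<in> le" by (rule le_trans[OF s(1) r3q])
      ultimately have "late_values le (hitting F' K) s (Max (insert M E)) \<noteq> {}"
        unfolding frequent_def by simp
      then obtain t k D where t: "(t, k, D) \<in> hitting F' K" "(t, s) \<in> le" "Max (insert M E) < k"
        unfolding late_values_def by auto
      have tP: "t \<in> P" using t(2) by (rule le_in)
      have tK: "(t, k, D) \<in> K" and hits: "\<And>a. a \<in> F' \<Longrightarrow> D \<inter> a \<noteq> {}"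
        using t(1) unfolding hitting_def by auto
      have kM: "M < k" "k \<notin> E" using t(3) r2(2) by (auto simp: Max_less_iff)
      have DM: "D \<in> late_values le K s M" unfolding late_values_def using tK t(2) kM(1) by auto
      have mem: "num_mem k x t" if x: "x \<in> T" for x
      proof -
        have "b x \<inter> D \<noteq> {}"
        proof (cases "b x \<in> S")
          case True
          then have "b x \<in> F'" using x unfolding F'_def by simp
          then show ?thesis using hits[of "b x"] by blast
        next
          case False
          then show ?thesis using bspec[OF M x] False DM by blast
        qed
        then show ?thesis
          using b_trace[OF x t(2)] num_mem_index_name[OF tK] meets_K[OF tK] by simp
      qed
      have t3: "(t, r3) \<in> le" by (rule le_trans[OF t(2) s(1)])
      have "fAll set_names (\<lambda>x. set_mem x F \<^bold>\<longrightarrow> num_mem k x) t"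
      proof (intro fAllI fImpI)
        fix x u assume x: "x \<in> set_names" and u: "(u, t) \<in> le" and xF: "set_mem x F u"
        have uP: "u \<in> P" using u by (rule le_in)
        have "set_mem x (up T) u"
          using xF family_eq_at[OF T(3) x le_trans[OF u t3]] by simp
        then have d: "densely (\<lambda>p. \<exists>y\<in>T. set_eq x y p) u" unfolding set_mem_up .
        show "num_mem k x u"
        proof (rule regularD[OF regular_num_mem uP], rule denselyI)
          fix v assume v: "(v, u) \<in> le"
          obtain w where w: "(w, v) \<in> le" "\<exists>y\<in>T. set_eq x y w" using d v by (rule denselyE)
          then obtain y where y: "y \<in> T" "set_eq x y w" by blast
          have "(w, t) \<in> le" by (rule le_trans[OF w(1) le_trans[OF v u]])
          then have "num_mem k y w"
            using hereditaryD[OF regular_hereditary[OF regular_num_mem] mem[OF y(1)]] by simp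
          then have "num_mem k x w" using set_eq_at[OF y(2) le_in(1)[OF w(1)]] by simp
          then show "\<exists>w. (w, v) \<in> le \<and> num_mem k x w" using w(1) by blast
        qed
      qed
      then have "k \<in> E" using r2(3)[OF le_trans[OF t3 r3]] by simp
      then show False using kM(2) by simp
    qed
  qed
qed

lemma fin_intersecting_check:
  assumes A: "almost_disjoint_family A" and abs: "absorbing P le A" and p: "p \<in> P"
  shows "f_fin_intersecting (check_family A) p"
  unfolding f_fin_intersecting_def
proof (intro fAndI fAllI fImpI)
  show "f_almost_disjoint_family (check_family A) p" by (rule almost_disjoint_check[OF A p])
next
  fix C q assume q: "(q, p) \<in> le" and C: "f_fin_sequence C q"
  let ?X = "check_family A"
  show "fEx set_names (\<lambda>I. (\<^bold>\<not> fin_set I) \<^bold>\<and> f_centered (infinite_trace ?X C I)) q"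
    unfolding fEx_eq
  proof (rule denselyI)
    fix r assume r: "(r, q) \<in> le"
    have rP: "r \<in> P" using r by (rule le_in)
    have Cr: "f_fin_sequence C r" by (rule hereditaryD[OF hereditary_f_fin_sequence C r])
    have "\<exists>q' K' S. (q', r) \<in> le \<and> captures le A (approximation_of C r) q' K' S"
      by (rule absorbingD[OF abs rP approximates_approximation_of[OF Cr] frequent_approximation_of[OF Cr]])
    then obtain q1 K S where q1: "(q1, r) \<in> le" and cap: "captures le A (approximation_of C r) q1 K S"
      by (elim exE conjE)
    have q1P: "q1 \<in> P" using q1 by (rule le_in)
    have sub: "K \<subseteq> approximation_of C r" by (rule capturesD(1)[OF cap])
    have "index_name K \<in> set_names"
      using sub le_in(1) unfolding index_name_def set_names_def approximation_of_def by auto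
    moreover have "(\<^bold>\<not> fin_set (index_name K)) q1"
      unfolding fNot_def
    proof (intro allI impI notI)
      fix s assume s: "(s, q1) \<in> le" and fin: "fin_set (index_name K) s"
      obtain t E where t: "(t, s) \<in> le" "finite E" "\<And>u n. (u, t) \<in> le \<Longrightarrow> num_mem n (index_name K) u \<longleftrightarrow> n \<in> E"
        using fin unfolding fin_set_def by (rule fin_numE[OF _ _ le_in(1)[OF s]]) simp_all
      have "frequent le (hitting {} K) q1" by (rule capturesD(4)[OF cap]) simp_all
      then have "late_values le K t (Max (insert 0 E)) \<noteq> {}"
        using le_trans[OF t(1) s] unfolding frequent_def by simp
      then obtain u k D where u: "(u, k, D) \<in> K" "(u, t) \<in> le" "Max (insert 0 E) < k"
        unfolding late_values_def by auto
      have "k \<in> E" using num_mem_index_name[OF u(1)] t(3)[OF u(2)] by simp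
      then show False using u(3) t(2) by (auto simp: Max_less_iff)
    qed
    moreover have "f_centered (infinite_trace ?X C (index_name K)) q1"
      by (rule centered_index_name[OF sub cap q1P])
    ultimately show "\<exists>s. (s, r) \<in> le \<and>
        (\<exists>I\<in>set_names. ((\<^bold>\<not> fin_set I) \<^bold>\<and> f_centered (infinite_trace ?X C I)) s)"
      using q1 fAndI by blast
  qed
qed

end

section \<open>Generic existence\<close>

theorem theorem32:
  fixes P :: "'p set" and le :: "'p rel" and one :: 'p
  assumes "continuum_hypothesis"
    and "forcing_poset P le one"
    and "countable P"
  shows "(\<forall>B. almost_disjoint_family B \<and> countable B \<longrightarrow>
            (\<exists>A. B \<subseteq> A \<and> mad A \<and> forcing_poset.indestructible P le one A \<and> fin_intersecting A \<and>
               forcing_poset.preserved_fin_intersecting P le one A)) \<and>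
         exist_generically (\<lambda>A. mad A \<and> forcing_poset.indestructible P le one A \<and>
            fin_intersecting A \<and> forcing_poset.preserved_fin_intersecting P le one A)"
proof -
  interpret forcing_poset P le one by fact
  have main: "\<exists>A. almost_disjoint_family A \<and> B \<subseteq> A \<and> mad A \<and> indestructible A \<and> fin_intersecting A \<and>
      preserved_fin_intersecting A"
    if B: "almost_disjoint_family B" "countable B" for B
  proof -
    obtain A where A: "B \<subseteq> A" "almost_disjoint_family A" "absorbing P le A"
      "absorbing {()} trivial_order A"
      by (rule absorbing_family_exists[OF assms(1,3) preorder B])
    have "mad A" by (rule absorbing_trivial_imp_mad[OF A(2,4)])
    moreover have "fin_intersecting A" by (rule absorbing_trivial_imp_fin_intersecting[OF A(2,4)])
    moreover have "indestructible A"
      unfolding indestructible_def forced_def using \<open>mad A\<close> mad_check[OF A(2,3)] by blast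
    moreover have "preserved_fin_intersecting A"
      unfolding preserved_fin_intersecting_def forced_def using fin_intersecting_check[OF A(2,3)] by blast
    ultimately show ?thesis using A(1,2) by blast
  qed
  moreover have "exist_generically (\<lambda>A. mad A \<and> indestructible A \<and>
      fin_intersecting A \<and> preserved_fin_intersecting A)"
    unfolding exist_generically_def
  proof (intro allI impI, elim conjE)
    fix B :: "nat set set"
    assume B: "almost_disjoint_family B" "|B| <o |UNIV :: nat set set|"
    \<comment> \<open>Under CH, size less than continuum means countable.\<close>
    have "countable B" by (rule countable_if_less_continuum[OF assms(1) B(2)])
    then show "\<exists>A. almost_disjoint_family A \<and> B \<subseteq> A \<and>
        mad A \<and> indestructible A \<and> fin_intersecting A \<and> preserved_fin_intersecting A"
      by (rule main[OF B(1)])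
  qed
  ultimately show ?thesis by blast
qed

end
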